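(* For all integers $n\geq 0$ with $3\nmid n$ and all integers $k\geq 0$, we have $$A_4\left(3^{2k+1}n+\frac{3^{2k+2}-5}{4}\right)= \frac{3^{4k+4}-1}{80}A_4(3n+1).$$ Consequently, for all integers $n\geq 0$ with $3\nmid n$ and all integers $k\geq 0$, we have $$A_4\left(3^{2k+1}n+\frac{3^{2k+2}-5}{4}\right) \equiv 0\pmod{\frac{3(3^{4k+4}-1)}{40}}.$$
   Context: For an integer $m\geq 1$, put $f_m := \prod_{n=1}^\infty (1-q^{mn})$ (as a formal power series in $q$, or for complex $|q|<1$). A partition is $4$-core if none of the hook lengths in its Ferrers--Young diagram is divisible by $4$. $A_4(n)$ denotes the number of partition pairs of $n$ with $4$-cores, i.e. pairs of partitions $(\lambda,\mu)$, both $4$-core, such that the sum of all parts of $\lambda$ and $\mu$ is $n$ (with $A_4(0)=1$). Its generating function is $\sum_{n=0}^\infty A_4(n)q^n = f_4^8/f_1^2$. *)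

theory Defs
  imports "HOL-Number_Theory.Cong"
begin

text \<open>A partition is the weakly decreasing list of its positive parts; it is a partition of
  the sum of the list.\<close>

definition is_partition :: "nat list \<Rightarrow> bool" where
  "is_partition xs \<longleftrightarrow> sorted_wrt (\<ge>) xs \<and> 0 \<notin> set xs"

text \<open>Cells are pairs (row, column), both counted from 0.\<close>

definition ferrers :: "nat list \<Rightarrow> (nat \<times> nat) set" where
  "ferrers xs = {(i, j). i < length xs \<and> j < xs ! i}"

definition hook :: "nat list \<Rightarrow> nat \<times> nat \<Rightarrow> (nat \<times> nat) set" where
  "hook xs c = {(i, j) \<in> ferrers xs. (i = fst c \<and> snd c \<le> j) \<or> (j = snd c \<and> fst c \<le> i)}"

definition hook_length :: "nat list \<Rightarrow> nat \<times> nat \<Rightarrow> nat" where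
  "hook_length xs c = card (hook xs c)"

definition is_core :: "nat \<Rightarrow> nat list \<Rightarrow> bool" where
  "is_core t xs \<longleftrightarrow> (\<forall>c \<in> ferrers xs. \<not> t dvd hook_length xs c)"

definition core_pairs :: "nat \<Rightarrow> nat \<Rightarrow> (nat list \<times> nat list) set" where
  "core_pairs t n = {(xs, ys). is_partition xs \<and> is_partition ys \<and> is_core t xs \<and> is_core t ys
     \<and> sum_list xs + sum_list ys = n}"

definition A\<^sub>4 :: "nat \<Rightarrow> nat" where
  "A\<^sub>4 n = card (core_pairs 4 n)"

lemma length_le_sum_list:
  assumes "0 \<notin> set (xs :: nat list)"
  shows "length xs \<le> sum_list xs"
  using assms by (induction xs) auto

lemma finite_core_pairs: "finite (core_pairs t n)"
proof -
  let ?L = "{xs. set xs \<subseteq> {..n} \<and> length xs \<le> n}"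
  have L: "xs \<in> ?L" if "is_partition xs" "sum_list xs \<le> n" for xs
  proof -
    have "length xs \<le> n"
      using that length_le_sum_list[of xs] by (simp add: is_partition_def)
    moreover have "x \<le> n" if "x \<in> set xs" for x
      using member_le_sum_list[OF that] \<open>sum_list xs \<le> n\<close> by simp
    ultimately show ?thesis by auto
  qed
  have "core_pairs t n \<subseteq> ?L \<times> ?L"
  proof (rule subrelI)
    fix xs ys assume "(xs, ys) \<in> core_pairs t n"
    then show "(xs, ys) \<in> ?L \<times> ?L"
      using L[of xs] L[of ys] by (simp add: core_pairs_def)
  qed
  moreover have "finite ?L"
    by (rule finite_lists_length_le) simp
  ultimately show ?thesis
    by (meson finite_SigmaI finite_subset)
qed

text \<open>The divisions on natural numbers occurring in the theorem are exact, and
  the subtractions do not truncate.\<close>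

lemma nine_power_exact: "5 \<le> (3::nat) ^ (2 * k + 2)" "4 dvd (3::nat) ^ (2 * k + 2) - 5"
proof -
  have "\<exists>m. (3::nat) ^ (2 * k + 2) = 4 * m + 5"
  proof (induction k)
    case 0
    show ?case by (rule exI[of _ 1]) simp
  next
    case (Suc k)
    then obtain m where "(3::nat) ^ (2 * k + 2) = 4 * m + 5" ..
    then have "(3::nat) ^ (2 * Suc k + 2) = 4 * (9 * m + 10) + 5" by simp
    then show ?case ..
  qed
  then show "5 \<le> (3::nat) ^ (2 * k + 2)" "4 dvd (3::nat) ^ (2 * k + 2) - 5"
    by auto
qed

lemma eightyone_power_exact:
  "80 dvd (3::nat) ^ (4 * k + 4) - 1" "40 dvd 3 * ((3::nat) ^ (4 * k + 4) - 1)"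
proof -
  have "\<exists>m. (3::nat) ^ (4 * k + 4) = 80 * m + 1"
  proof (induction k)
    case 0
    show ?case by (rule exI[of _ 1]) simp
  next
    case (Suc k)
    then obtain m where "(3::nat) ^ (4 * k + 4) = 80 * m + 1" ..
    moreover have "(3::nat) ^ (4 * Suc k + 4) = 81 * 3 ^ (4 * k + 4)"
      by (simp add: power_add)
    ultimately have "(3::nat) ^ (4 * Suc k + 4) = 80 * (81 * m + 1) + 1" by simp
    then show ?case ..
  qed
  then obtain m where m: "(3::nat) ^ (4 * k + 4) = 80 * m + 1" ..
  show "80 dvd (3::nat) ^ (4 * k + 4) - 1"
    by (simp only: m) simp
  show "40 dvd 3 * ((3::nat) ^ (4 * k + 4) - 1)"
    by (simp only: m) (simp add: dvd_mult)
qed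

end

theory Submission
  imports Defs "HOL-Library.Numeral_Type" "HOL-Library.FuncSet" "HOL-Combinatorics.Transposition"
begin

text \<open>Write N = 4n + 5. The numbers of the theorem are those with N = 3^(2k+1) m, where m =
  4n' + 3 is prime to 3 (here n' is the n of the theorem). The generating function of A_4(n),
  indexed by N, is a modular form of weight 3. It is the sum of an Eisenstein series and a
  multiple of the cusp form eta(4z)^6, which has complex multiplication by the Gaussian integers
  and whose coefficients therefore vanish at the numbers that contain the prime 3 exactly to an
  odd power. Along such numbers only the Eisenstein part is visible, and its Hecke recursion at 9
  gives the theorem. Everything below is an elementary version of this argument, in which each
  step is a bijection or a symmetry of integer vectors.

  Pairs of 4-cores become sums of six squares. A partition is recorded by its beta-set, the set of
  hook lengths of its first column; being a 4-core means that the beta-set is closed under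
  subtracting 4 (is_core_iff_closed). On the abacus with four runners this leaves three free
  parameters. A symmetrisation of these gives that 8 times the number of 4-cores of n is the
  number of solutions of q^2 + 2y^2 + 2z^2 = 8n + 5 in odd integers (card_cores). Two such
  equations combine into one: 64 A_4(n) counts the vectors of norm N in Z^6 whose first two
  entries have different parity and whose last four entries are odd (A4_eq_card_sextuples_odd).

  The cusp form is removed by Jacobi's identity for the cube of the Euler product, in the form
  that the signed count of the representations K = p^2 + u^2 + v^2 vanishes unless K is a square
  (ternary_eq_unary, ternary_coeff_nonsquare). If 2N is not a sum of two squares, then the two
  kinds of sextuples, with four odd and with four even last entries, are equally numerous, and so
  the number r(N) of all vectors of norm N in Z^6 is 384 A_4(n) (six_squares_eq_A4).

  The Hecke recursion for r comes from the lattices that are neighbours of Z^6 at 3. There are 112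
  of them, one for each isotropic line modulo 3, and each is the image of Z^6 under the reflection
  in a vector with entries in {-1, 0, 1} and norm 3 or 6. Counting in two ways the vectors of norm
  N that lie in one of these lattices but not in Z^6 gives r(9N) + 81 r(N/9) = 82 r(N) for N
  divisible by 3 (neighbour_recurrence). For N = 3^(2k+1) m this is a linear recursion in k with
  characteristic roots 1 and 81, whose solution with vanishing term at k = -1 is the asserted
  factor 1 + 81 + ... + 81^k.

  For the congruence it remains to see that A_4(3n'+1) is divisible by 6. A symmetry of order 3
  without fixed points, multiplication by a unit of the Hurwitz quaternions, gives the factor 3;
  exchanging the two cores, or the two variables y and z, gives the factor 2 (six_dvd_A4).\<close>

section \<open>Counting along cyclic symmetries\<close>

text \<open>If a permutation of S shifts the residue f modulo k by a unit c, then it carries the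
  fibres of f into one another and all of them have the same size. This covers every symmetry
  argument below in which one out of k equivalent choices is singled out: signs, transpositions,
  rotations, translations modulo 3.\<close>

lemma card_eq_mult_card_fibre:
  fixes f :: "'a \<Rightarrow> int" and c k :: int
  assumes fin: "finite S" and map: "\<And>x. x \<in> S \<Longrightarrow> \<sigma> x \<in> S" and inj: "inj_on \<sigma> S"
    and shift: "\<And>x. x \<in> S \<Longrightarrow> [f (\<sigma> x) = f x + c] (mod k)"
    and cop: "coprime c k" and k: "k > 0"
  shows "card S = nat k * card {x \<in> S. [f x = a] (mod k)}"
proof -
  define F where "F b = {x \<in> S. [f x = b] (mod k)}" for b
  have finF: "finite (F b)" for b using fin by (simp add: F_def)
  have step: "card (F b) \<le> card (F (b + c))" for b
  proof (rule card_inj_on_le[where f = \<sigma>])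
    show "inj_on \<sigma> (F b)" using inj by (rule inj_on_subset) (auto simp: F_def)
    show "\<sigma> ` F b \<subseteq> F (b + c)"
    proof (intro subsetI, elim imageE, hypsubst)
      fix x assume "x \<in> F b"
      then have x: "x \<in> S" "[f x = b] (mod k)" by (auto simp: F_def)
      then have "[f (\<sigma> x) = b + c] (mod k)"
        using cong_trans[OF shift[OF x(1)]] by (simp add: cong_add_rcancel)
      then show "\<sigma> x \<in> F (b + c)" using map x by (simp add: F_def)
    qed
  qed (rule finF)
  have steps: "card (F b) \<le> card (F (b + int j * c))" for b j
  proof (induction j)
    case (Suc j)
    then show ?case using step[of "b + int j * c"] by (simp add: algebra_simps)
  qed simp
  have le: "card (F b) \<le> card (F a')" for a' b
  proof -
    obtain x where x: "[c * x = 1] (mod k)" using cong_solve_coprime_int[OF cop] by auto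
    define j where "j = nat ((a' - b) * x mod k)"
    have "[int j = (a' - b) * x] (mod k)" using k by (simp add: j_def cong_def)
    then have "[int j * c = (a' - b) * (c * x)] (mod k)"
      by (metis cong_scalar_right mult.assoc mult.commute)
    also have "[(a' - b) * (c * x) = (a' - b) * 1] (mod k)" using x by (rule cong_scalar_left)
    finally have "[int j * c = a' - b] (mod k)" by simp
    then have "[b + int j * c = b + (a' - b)] (mod k)"
      by (simp only: cong_add_lcancel)
    then have "F (b + int j * c) = F a'" unfolding F_def by (auto simp: cong_def)
    then show ?thesis using steps[of b j] by simp
  qed
  have eq: "card (F b) = card (F a)" for b using le by (simp add: le_antisym)
  have "S = (\<Union>b\<in>{0..<k}. F b)"
    using k by (auto simp: F_def cong_def intro!: bexI[of _ "f _ mod k"])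
  then have "card S = card (\<Union>b\<in>{0..<k}. F b)" by simp
  also have "\<dots> = (\<Sum>b\<in>{0..<k}. card (F b))"
    by (intro card_UN_disjoint) (use fin in \<open>auto simp: F_def cong_def\<close>)
  also have "\<dots> = (\<Sum>b\<in>{0..<k}. card (F a))" by (intro sum.cong refl eq)
  also have "\<dots> = nat k * card (F a)" by simp
  finally show ?thesis by (simp add: F_def)
qed

text \<open>The orbits have three elements each.\<close>

lemma three_dvd_card:
  assumes fin: "finite S" and map: "\<And>x. x \<in> S \<Longrightarrow> \<sigma> x \<in> S"
    and ord: "\<And>x. x \<in> S \<Longrightarrow> \<sigma> (\<sigma> (\<sigma> x)) = x" and free: "\<And>x. x \<in> S \<Longrightarrow> \<sigma> x \<noteq> x"
  shows "3 dvd card S"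
proof -
  define C where "C x = {x, \<sigma> x, \<sigma> (\<sigma> x)}" for x
  have "\<Union>(C ` S) = S" using map by (auto simp: C_def)
  moreover have "3 dvd card (\<Union>(C ` S))"
  proof (rule dvd_partition)
    show "finite (\<Union>(C ` S))" using fin \<open>\<Union>(C ` S) = S\<close> by simp
    show "\<forall>c\<in>C ` S. 3 dvd card c"
    proof
      fix c assume "c \<in> C ` S"
      then obtain x where x: "x \<in> S" "c = C x" by blast
      have "\<sigma> x \<noteq> x" "\<sigma> (\<sigma> x) \<noteq> \<sigma> x" "\<sigma> (\<sigma> x) \<noteq> x"
        using free ord map x(1) by metis+
      then have "card (C x) = 3" by (simp add: C_def eq_commute numeral_3_eq_3)
      then show "3 dvd card c" by (simp add: x(2))
    qed
    have sub: "C y = C x" if "x \<in> S" "y \<in> C x" for x y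
      using that ord by (auto simp: C_def)
    show "\<forall>c1\<in>C ` S. \<forall>c2\<in>C ` S. c1 \<noteq> c2 \<longrightarrow> c1 \<inter> c2 = {}"
      using sub by blast
  qed
  ultimately show ?thesis by simp
qed

lemma abs_le_of_square_le:
  fixes x N :: int
  assumes "x\<^sup>2 \<le> N" shows "x \<in> {-N..N}"
proof -
  have "\<bar>x\<bar> \<le> x\<^sup>2"
    using mult_right_mono[of 1 "\<bar>x\<bar>" "\<bar>x\<bar>"] by (cases "x = 0") (auto simp: power2_eq_square)
  then show ?thesis using assms abs_le_iff[of x N] by auto
qed

section \<open>Cores and beta-sets\<close>

text \<open>The elements are the hook lengths of the first column. The smallest part is last in
  the list, so the sizes of the elements increase from the end of the list to its head.\<close>

fun beta_set :: "nat list \<Rightarrow> nat set" where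
  "beta_set [] = {}"
| "beta_set (x # xs) = insert (x + length xs) (beta_set xs)"

lemma is_partition_Cons:
  "is_partition (x # xs) \<longleftrightarrow> 0 < x \<and> (\<forall>y\<in>set xs. y \<le> x) \<and> is_partition xs"
  by (auto simp: is_partition_def)

lemma beta_set_conv: "beta_set xs = {xs ! i + (length xs - Suc i) |i. i < length xs}"
proof (induction xs)
  case (Cons x xs)
  have "{(x # xs) ! i + (length (x # xs) - Suc i) |i. i < length (x # xs)}
      = insert (x + length xs) {xs ! i + (length xs - Suc i) |i. i < length xs}"
    (is "?A = insert _ ?B")
  proof (intro equalityI subsetI)
    fix y assume "y \<in> ?A"
    then obtain i where i: "i < Suc (length xs)" "y = (x # xs) ! i + (length xs - i)" by auto
    show "y \<in> insert (x + length xs) ?B"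
    proof (cases i)
      case (Suc k)
      then have "k < length xs" "y = xs ! k + (length xs - Suc k)" using i by auto
      then show ?thesis by blast
    qed (use i in simp)
  next
    fix y assume "y \<in> insert (x + length xs) ?B"
    then consider "y = x + length xs" | i where "i < length xs" "y = xs ! i + (length xs - Suc i)" by auto
    then show "y \<in> ?A"
    proof cases
      case 1
      then show ?thesis by (intro CollectI exI[of _ 0]) auto
    next
      case 2
      then show ?thesis by (intro CollectI exI[of _ "Suc i"]) auto
    qed
  qed
  then show ?case using Cons by simp
qed simp

text \<open>The head of the list yields the largest element. With this, a partition can be
  recovered from its beta-set by removing the maximum.\<close>

lemma beta_less:
  assumes "is_partition (x # xs)" "b \<in> beta_set xs" shows "b < x + length xs"
proof -
  obtain i where i: "i < length xs" "b = xs ! i + (length xs - Suc i)"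
    using assms(2) unfolding beta_set_conv by blast
  have "xs ! i \<le> x" using assms(1) i(1) by (simp add: is_partition_Cons)
  then show ?thesis using i by simp
qed

lemma finite_beta: "finite (beta_set xs)" by (induction xs) auto

lemma card_beta: "is_partition xs \<Longrightarrow> card (beta_set xs) = length xs"
proof (induction xs)
  case (Cons x xs)
  then show ?case using beta_less[OF Cons.prems] by (auto simp: finite_beta is_partition_Cons card_insert_if)
qed simp

lemma zero_notin_beta: "is_partition xs \<Longrightarrow> 0 \<notin> beta_set xs"
  by (induction xs) (auto simp: is_partition_Cons)

text \<open>The elements exceed the parts by 0, 1, 2 and so on; the doubling avoids a
  division.\<close>

lemma sum_beta: "is_partition xs \<Longrightarrow> 2 * \<Sum>(beta_set xs) = 2 * sum_list xs + length xs * (length xs - 1)"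
proof (induction xs)
  case (Cons x xs)
  have "x + length xs \<notin> beta_set xs" using beta_less[OF Cons.prems] by blast
  then have "2 * \<Sum>(beta_set (x # xs)) = 2 * (x + length xs) + 2 * \<Sum>(beta_set xs)" by (simp add: finite_beta)
  also have "\<dots> = 2 * (x + length xs) + (2 * sum_list xs + length xs * (length xs - 1))"
    using Cons by (simp add: is_partition_Cons)
  also have "\<dots> = 2 * sum_list (x # xs) + length (x # xs) * (length (x # xs) - 1)"
    by (cases xs) (auto simp: algebra_simps)
  finally show ?case .
qed simp

lemma inj_beta: "inj_on beta_set {xs. is_partition xs}"
proof (rule inj_onI)
  fix xs ys assume "xs \<in> {xs. is_partition xs}" "ys \<in> {xs. is_partition xs}" "beta_set xs = beta_set ys"
  then show "xs = ys"
  proof (induction xs arbitrary: ys)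
    case Nil
    then show ?case by (cases ys) auto
  next
    case (Cons x xs)
    then obtain y zs where ys: "ys = y # zs" by (cases ys) auto
    have px: "is_partition (x # xs)" "is_partition xs" and py: "is_partition (y # zs)" "is_partition zs"
      using Cons.prems by (auto simp: ys is_partition_Cons)
    have len: "length xs = length zs"
      using card_beta[OF px(1)] card_beta[OF py(1)] Cons.prems(3) by (simp add: ys)
    have Max: "Max (beta_set (u # us)) = u + length us" if "is_partition (u # us)" for u us
      using beta_less[OF that] by (intro Max_eqI) (auto simp: finite_beta less_imp_le)
    have xy: "x + length xs = y + length zs"
      using Max[OF px(1)] Max[OF py(1)] Cons.prems(3) by (simp add: ys)
    have "beta_set xs = beta_set (x # xs) - {x + length xs}" using beta_less[OF px(1)] by auto
    also have "\<dots> = beta_set (y # zs) - {y + length zs}" using Cons.prems(3) xy by (simp only: ys)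
    also have "\<dots> = beta_set zs" using beta_less[OF py(1)] by auto
    finally have b: "beta_set xs = beta_set zs" .
    have "xs = zs" by (rule Cons.IH) (simp_all only: mem_Collect_eq px py b)
    then show ?case using xy len by (simp add: ys)
  qed
qed

lemma surj_beta:
  assumes "finite X" "0 \<notin> X" obtains xs where "is_partition xs" "beta_set xs = X"
proof -
  have "\<exists>xs. is_partition xs \<and> beta_set xs = X" using assms
  proof (induction X rule: finite_linorder_max_induct)
    case empty
    show ?case by (rule exI[of _ "[]"]) (simp add: is_partition_def)
  next
    case (insert b A)
    then obtain xs where xs: "is_partition xs" "beta_set xs = A" by auto
    have hd: "y + length xs \<le> b" if "y \<in> set xs" for y
    proof (cases xs)
      case Nil then show ?thesis using that by simp
    next
      case (Cons z zs)
      then have "z + length zs < b" using insert.hyps xs(2) by auto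
      moreover have "y \<le> z" using that xs(1) Cons by (auto simp: is_partition_Cons)
      ultimately show ?thesis using Cons by simp
    qed
    have "length xs < b"
    proof (cases xs)
      case Nil then show ?thesis using insert.prems by auto
    next
      case (Cons z zs)
      then have "0 < z" using xs(1) by (simp add: is_partition_Cons)
      then show ?thesis using hd[of z] Cons by simp
    qed
    then have "is_partition ((b - length xs) # xs) \<and> beta_set ((b - length xs) # xs) = insert b A"
      using hd xs by (force simp: is_partition_Cons)
    then show ?case by blast
  qed
  then show ?thesis using that by blast
qed

lemma ferrers_Cons: "ferrers (x # xs) = {0} \<times> {..<x} \<union> (\<lambda>(i, j). (Suc i, j)) ` ferrers xs"
proof (intro equalityI subsetI)
  fix c assume "c \<in> ferrers (x # xs)"
  then obtain i j where c: "c = (i, j)" "i < Suc (length xs)" "j < (x # xs) ! i" by (auto simp: ferrers_def)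
  then show "c \<in> {0} \<times> {..<x} \<union> (\<lambda>(i, j). (Suc i, j)) ` ferrers xs"
    by (cases i) (auto simp: ferrers_def image_iff)
qed (auto simp: ferrers_def)

lemma hook_length_Suc: "hook_length (x # xs) (Suc i, j) = hook_length xs (i, j)"
proof -
  have "hook (x # xs) (Suc i, j) = (\<lambda>(i, j). (Suc i, j)) ` hook xs (i, j)"
    by (auto simp: hook_def ferrers_Cons image_iff)
  moreover have "inj_on (\<lambda>(i, j). (Suc i, j)) (hook xs (i, j))" by (auto simp: inj_on_def)
  ultimately show ?thesis by (simp add: hook_length_def card_image)
qed

lemma hook_length_0:
  assumes "j < x"
  shows "hook_length (x # xs) (0, j) = x - j + card {i. i < length xs \<and> j < xs ! i}"
proof -
  have "hook (x # xs) (0, j) = {0} \<times> {j..<x} \<union> (\<lambda>i. (Suc i, j)) ` {i. i < length xs \<and> j < xs ! i}"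
  proof (intro equalityI subsetI)
    fix c assume "c \<in> hook (x # xs) (0, j)"
    then show "c \<in> {0} \<times> {j..<x} \<union> (\<lambda>i. (Suc i, j)) ` {i. i < length xs \<and> j < xs ! i}"
      by (cases "fst c") (auto simp: hook_def ferrers_def)
  qed (use assms in \<open>auto simp: hook_def ferrers_def\<close>)
  moreover have "card ({0 :: nat} \<times> {j..<x} \<union> (\<lambda>i. (Suc i, j)) ` {i. i < length xs \<and> j < xs ! i})
     = card ({0 :: nat} \<times> {j..<x}) + card ((\<lambda>i. (Suc i, j)) ` {i. i < length xs \<and> j < xs ! i})"
    by (rule card_Un_disjoint) auto
  moreover have "card ((\<lambda>i. (Suc i, j)) ` {i. i < length xs \<and> j < xs ! i}) = card {i. i < length xs \<and> j < xs ! i}"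
    by (rule card_image) (auto simp: inj_on_def)
  ultimately show ?thesis by (simp add: hook_length_def)
qed

text \<open>The lower boundary of the diagram is a lattice path. Numbering its steps from 0,
  starting at the lower left, the beta-set consists of the vertical steps, and the j-th horizontal
  step, which ends column j, is the j-th gap. A hook of the first row is the piece of the path
  from a gap to the step x + length xs that ends the first row.\<close>

lemma gaps_eq_hook_lengths:
  assumes p: "is_partition (x # xs)"
  shows "(\<lambda>j. hook_length (x # xs) (0, j)) ` {..<x}
       = (\<lambda>y. x + length xs - y) ` ({..<x + length xs} - beta_set xs)"
proof -
  \<comment> \<open>The position of the horizontal step that ends column j.\<close>
  define g where "g j = j + card {i. i < length xs \<and> xs ! i \<le> j}" for j
  have part: "is_partition xs" and le: "\<And>y. y \<in> set xs \<Longrightarrow> y \<le> x" using p by (auto simp: is_partition_Cons)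
  have compl: "card {i. i < length xs \<and> j < xs ! i} + card {i. i < length xs \<and> xs ! i \<le> j} = length xs" for j
  proof -
    have "card {i. i < length xs \<and> j < xs ! i} + card {i. i < length xs \<and> xs ! i \<le> j}
      = card ({i. i < length xs \<and> j < xs ! i} \<union> {i. i < length xs \<and> xs ! i \<le> j})"
      by (rule card_Un_disjoint[symmetric]) auto
    also have "{i. i < length xs \<and> j < xs ! i} \<union> {i. i < length xs \<and> xs ! i \<le> j} = {..<length xs}" by auto
    finally show ?thesis by simp
  qed
  have hg: "hook_length (x # xs) (0, j) = x + length xs - g j" if "j < x" for j
    using hook_length_0[OF that, of xs] compl[of j] that by (simp add: g_def)
  have mono: "g j < g k" if "j < k" for j k
  proof -
    have "card {i. i < length xs \<and> xs ! i \<le> j} \<le> card {i. i < length xs \<and> xs ! i \<le> k}"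
      using that by (intro card_mono) auto
    then show ?thesis using that by (simp add: g_def)
  qed
  have antimono: "xs ! k \<le> xs ! i" if "i \<le> k" "k < length xs" for i k
    using part that unfolding is_partition_def by (cases "i = k") (auto simp: sorted_wrt_iff_nth_less)
  have gap: "g j \<notin> beta_set xs" for j
  proof
    assume "g j \<in> beta_set xs"
    then obtain i where i: "i < length xs" "g j = xs ! i + (length xs - Suc i)" unfolding beta_set_conv by blast
    show False
    proof (cases "xs ! i \<le> j")
      case True
      have "{i..<length xs} \<subseteq> {i. i < length xs \<and> xs ! i \<le> j}"
      proof
        fix k assume "k \<in> {i..<length xs}"
        then show "k \<in> {i. i < length xs \<and> xs ! i \<le> j}" using antimono[of i k] True by simp
      qed
      then have "length xs - i \<le> card {i. i < length xs \<and> xs ! i \<le> j}"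
        using card_mono[of "{i. i < length xs \<and> xs ! i \<le> j}" "{i..<length xs}"] by simp
      then show False using i True by (simp add: g_def)
    next
      case False
      have "k > i" if "xs ! k \<le> j" for k
        using antimono[of k i] that False i(1) by (meson leI order_trans)
      then have "{i. i < length xs \<and> xs ! i \<le> j} \<subseteq> {Suc i..<length xs}"
        by (auto simp: Suc_le_eq)
      then have "card {i. i < length xs \<and> xs ! i \<le> j} \<le> length xs - Suc i"
        using card_mono[of "{Suc i..<length xs}"] by fastforce
      then show False using i False by (simp add: g_def)
    qed
  qed
  have "g ` {..<x} = {..<x + length xs} - beta_set xs"
  proof (rule card_subset_eq)
    show "g ` {..<x} \<subseteq> {..<x + length xs} - beta_set xs"
    proof
      fix y assume "y \<in> g ` {..<x}"
      then obtain j where j: "j < x" "y = g j" by blast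
      have "g j < x + length xs" using j(1) compl[of j] by (simp add: g_def)
      then show "y \<in> {..<x + length xs} - beta_set xs" using gap j by auto
    qed
    have "inj_on g {..<x}" using mono by (metis inj_onI less_irrefl linorder_neqE_nat)
    moreover have "beta_set xs \<subseteq> {..<x + length xs}" using beta_less[OF p] by auto
    ultimately show "card (g ` {..<x}) = card ({..<x + length xs} - beta_set xs)"
      using card_beta[OF part] by (simp add: card_image card_Diff_subset finite_beta)
  qed simp
  then have "(\<lambda>y. x + length xs - y) ` ({..<x + length xs} - beta_set xs) = (\<lambda>j. x + length xs - g j) ` {..<x}"
    by (metis image_image)
  then show ?thesis using hg by auto
qed

text \<open>The hook lengths are the differences between an element and a smaller gap; rows other
  than the first are handled by the induction, since the larger elements contributed by higher
  rows do not affect the gaps below b.\<close>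

lemma is_core_iff_gaps:
  assumes "is_partition xs"
  shows "is_core t xs \<longleftrightarrow> (\<forall>b\<in>beta_set xs. \<forall>y<b. y \<notin> beta_set xs \<longrightarrow> \<not> t dvd b - y)"
  using assms
proof (induction xs)
  case Nil
  show ?case by (simp add: is_core_def ferrers_def)
next
  case (Cons x xs)
  let ?b = "x + length xs"
  have "is_core t (x # xs) \<longleftrightarrow> (\<forall>j<x. \<not> t dvd hook_length (x # xs) (0, j)) \<and> is_core t xs"
    by (auto simp: is_core_def ferrers_Cons hook_length_Suc ball_Un)
  also have "(\<forall>j<x. \<not> t dvd hook_length (x # xs) (0, j)) \<longleftrightarrow>
      (\<forall>h\<in>(\<lambda>j. hook_length (x # xs) (0, j)) ` {..<x}. \<not> t dvd h)" by auto
  also have "\<dots> \<longleftrightarrow> (\<forall>y<?b. y \<notin> beta_set xs \<longrightarrow> \<not> t dvd ?b - y)"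
    unfolding gaps_eq_hook_lengths[OF Cons.prems] by auto
  also have "is_core t xs \<longleftrightarrow> (\<forall>b\<in>beta_set xs. \<forall>y<b. y \<notin> beta_set xs \<longrightarrow> \<not> t dvd b - y)"
    using Cons.prems by (intro Cons.IH) (simp add: is_partition_Cons)
  also have "\<dots> \<longleftrightarrow> (\<forall>b\<in>beta_set xs. \<forall>y<b. y \<notin> insert ?b (beta_set xs) \<longrightarrow> \<not> t dvd b - y)"
  proof (intro ball_cong refl)
    fix b assume "b \<in> beta_set xs"
    then have "b < ?b" by (rule beta_less[OF Cons.prems])
    then show "(\<forall>y<b. y \<notin> beta_set xs \<longrightarrow> \<not> t dvd b - y) \<longleftrightarrow> (\<forall>y<b. y \<notin> insert ?b (beta_set xs) \<longrightarrow> \<not> t dvd b - y)"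
      by auto
  qed
  also have "(\<forall>y<?b. y \<notin> beta_set xs \<longrightarrow> \<not> t dvd ?b - y) \<longleftrightarrow> (\<forall>y<?b. y \<notin> insert ?b (beta_set xs) \<longrightarrow> \<not> t dvd ?b - y)"
    by auto
  finally show ?case by (simp only: beta_set.simps ball_simps)
qed

text \<open>If an element and a smaller gap differ by a multiple of t, then somewhere between
  them, in steps of t, an element is followed downwards by a gap.\<close>

lemma is_core_iff_closed:
  assumes "is_partition xs" "t > 0"
  shows "is_core t xs \<longleftrightarrow> (\<forall>b\<in>beta_set xs. t \<le> b \<longrightarrow> b - t \<in> beta_set xs)"
  unfolding is_core_iff_gaps[OF assms(1)]
proof (intro iffI ballI impI allI)
  fix b assume h: "\<forall>b\<in>beta_set xs. \<forall>y<b. y \<notin> beta_set xs \<longrightarrow> \<not> t dvd b - y" and b: "b \<in> beta_set xs" "t \<le> b"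
  moreover have "b - t < b" using b(2) assms(2) by simp
  ultimately have "b - t \<notin> beta_set xs \<longrightarrow> \<not> t dvd b - (b - t)" by blast
  then show "b - t \<in> beta_set xs" using b(2) by auto
next
  fix b y assume h: "\<forall>b\<in>beta_set xs. t \<le> b \<longrightarrow> b - t \<in> beta_set xs" and b: "b \<in> beta_set xs" "y < b" "y \<notin> beta_set xs"
  have step: "b - k * t \<in> beta_set xs" if "k * t \<le> b" for k using that
  proof (induction k)
    case 0 then show ?case using b by simp
  next
    case (Suc k)
    then have "b - k * t \<in> beta_set xs" "t \<le> b - k * t" by auto
    then have "b - k * t - t \<in> beta_set xs" using h by blast
    then show ?case by (simp add: diff_diff_left add.commute)
  qed
  show "\<not> t dvd b - y"
  proof
    assume "t dvd b - y"
    then obtain k where "b - y = k * t" by (metis dvd_def mult.commute)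
    then have "y = b - k * t" "k * t \<le> b" using b(2) by auto
    then show False using step b(3) by simp
  qed
qed

section \<open>Counting 4-cores by a ternary quadratic form\<close>

definition cores :: "nat \<Rightarrow> nat list set" where
  "cores n = {xs. is_partition xs \<and> is_core 4 xs \<and> sum_list xs = n}"

text \<open>An abacus with four runners, on which the beads are pushed down as far as possible.
  The runner of the multiples of 4 is empty, because its lowest position is 0, which is not a hook
  length.\<close>

definition runners :: "nat \<times> nat \<times> nat \<Rightarrow> nat set" where
  "runners = (\<lambda>(k, l, m). (\<lambda>i. 4 * i + 1) ` {..<k} \<union> (\<lambda>i. 4 * i + 2) ` {..<l} \<union> (\<lambda>i. 4 * i + 3) ` {..<m})"

lemma mem_runners:
  "4 * i + 1 \<in> runners (k, l, m) \<longleftrightarrow> i < k"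
  "4 * i + 2 \<in> runners (k, l, m) \<longleftrightarrow> i < l"
  "4 * i + 3 \<in> runners (k, l, m) \<longleftrightarrow> i < m"
  "4 * i \<notin> runners (k, l, m)"
  by (auto simp: runners_def image_iff; presburger)+

lemma mod4_cases: obtains i where "x = 4 * i" | i where "x = 4 * i + 1" | i where "x = 4 * i + 2" | i where "x = 4 * i + (3 :: nat)"
proof -
  have "x = 4 * (x div 4) + x mod 4" "x mod 4 < 4" by simp_all
  then have "x = 4 * (x div 4) \<or> x = 4 * (x div 4) + 1 \<or> x = 4 * (x div 4) + 2 \<or> x = 4 * (x div 4) + 3" by linarith
  then show ?thesis using that by blast
qed

lemma inj_runners: "inj runners"
proof (rule injI)
  fix x y assume eq: "runners x = runners y"
  obtain k l m where x: "x = (k, l, m)" by (cases x)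
  obtain k' l' m' where y: "y = (k', l', m')" by (cases y)
  have "i < k \<longleftrightarrow> i < k'" "i < l \<longleftrightarrow> i < l'" "i < m \<longleftrightarrow> i < m'" for i
    using eq mem_runners[of i k l m] mem_runners[of i k' l' m'] by (auto simp: x y)
  then show "x = y" unfolding x y by (metis linorder_neqE_nat less_irrefl)
qed

lemma finite_downset_nat:
  assumes "finite A" "\<And>i. Suc i \<in> A \<Longrightarrow> i \<in> A"
  obtains k :: nat where "\<And>i. i \<in> A \<longleftrightarrow> i < k"
proof -
  have down: "i \<in> A" if "i \<le> j" "j \<in> A" for i j
    using that by (induction rule: inc_induct) (auto intro: assms(2))
  define k where "k = (LEAST k. k \<notin> A)"
  have "\<exists>k. k \<notin> A" using assms(1) infinite_UNIV_nat by (metis UNIV_eq_I)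
  then have "k \<notin> A" unfolding k_def by (rule LeastI_ex)
  moreover have "i \<in> A" if "i < k" for i using not_less_Least that unfolding k_def by blast
  ultimately show ?thesis using down by (intro that[of k]) (metis linorder_not_le)
qed

text \<open>Being closed under subtracting 4 means that the occupied positions of each runner form
  an initial segment.\<close>

lemma range_runners:
  "range runners = {X. finite X \<and> 0 \<notin> X \<and> (\<forall>b\<in>X. 4 \<le> b \<longrightarrow> b - 4 \<in> X)}"
proof (intro equalityI subsetI)
  fix X assume "X \<in> range runners"
  then obtain k l m where X: "X = runners (k, l, m)" by auto
  have "finite X" by (simp add: X runners_def)
  moreover have "0 \<notin> X" by (auto simp: X runners_def)
  moreover have "b - 4 \<in> X" if b: "b \<in> X" "4 \<le> b" for b
  proof -
    obtain i where i: "b = 4 + i" using b(2) le_Suc_ex by blast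
    show ?thesis
    proof (cases i rule: mod4_cases)
      case (1 j)
      then show ?thesis using b mem_runners(4)[of "Suc j" k l m] by (simp add: X i)
    next
      case (2 j)
      then show ?thesis using b mem_runners(1)[of "Suc j" k l m] mem_runners(1)[of j k l m] by (simp add: X i)
    next
      case (3 j)
      then show ?thesis using b mem_runners(2)[of "Suc j" k l m] mem_runners(2)[of j k l m] by (simp add: X i)
    next
      case (4 j)
      then show ?thesis using b mem_runners(3)[of "Suc j" k l m] mem_runners(3)[of j k l m] by (simp add: X i add.commute)
    qed
  qed
  ultimately show "X \<in> {X. finite X \<and> 0 \<notin> X \<and> (\<forall>b\<in>X. 4 \<le> b \<longrightarrow> b - 4 \<in> X)}" by blast
next
  fix X :: "nat set" assume "X \<in> {X. finite X \<and> 0 \<notin> X \<and> (\<forall>b\<in>X. 4 \<le> b \<longrightarrow> b - 4 \<in> X)}"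
  then have X: "finite X" "0 \<notin> X" "\<And>b. b \<in> X \<Longrightarrow> 4 \<le> b \<Longrightarrow> b - 4 \<in> X" by auto
  have fin: "finite {i. 4 * i + r \<in> X}" for r
    using finite_vimageI[OF X(1), of "\<lambda>i. 4 * i + r"] by (simp add: inj_on_def vimage_def)
  have down: "4 * i + r \<in> X" if "4 * Suc i + r \<in> X" for i r using X(3)[OF that] by simp
  have ex: "\<exists>k. \<forall>i. 4 * i + r \<in> X \<longleftrightarrow> i < k" for r
    using finite_downset_nat[OF fin[of r]] down by (metis mem_Collect_eq)
  obtain k where k: "\<And>i. 4 * i + 1 \<in> X \<longleftrightarrow> i < k" using ex by blast
  obtain l where l: "\<And>i. 4 * i + 2 \<in> X \<longleftrightarrow> i < l" using ex by blast
  obtain m where m: "\<And>i. 4 * i + 3 \<in> X \<longleftrightarrow> i < m" using ex by blast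
  have zero: "4 * i \<notin> X" for i
  proof (induction i)
    case (Suc i)
    then show ?case using down[of i 0] by auto
  qed (use X(2) in simp)
  have "x \<in> X \<longleftrightarrow> x \<in> runners (k, l, m)" for x
    by (cases x rule: mod4_cases) (simp_all only: k l m zero mem_runners simp_thms)
  then show "X \<in> range runners" by blast
qed

lemma double_sum_progression:
  "2 * int (\<Sum>i<k. 4 * i + r) = 4 * (int k * (int k - 1)) + 2 * int r * int k"
  by (induction k) (auto simp: algebra_simps)

lemma runners_card_sum:
  "card (runners (k, l, m)) = k + l + m"
  "\<Sum>(runners (k, l, m)) = (\<Sum>i<k. 4 * i + 1) + (\<Sum>i<l. 4 * i + 2) + (\<Sum>i<m. 4 * i + 3)"
proof -
  let ?A = "(\<lambda>i :: nat. 4 * i + 1) ` {..<k}" and ?B = "(\<lambda>i :: nat. 4 * i + 2) ` {..<l}" and ?C = "(\<lambda>i :: nat. 4 * i + 3) ` {..<m}"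
  have inj: "inj_on (\<lambda>i :: nat. 4 * i + r) S" for r S by (auto simp: inj_on_def)
  have d: "?A \<inter> ?B = {}" "(?A \<union> ?B) \<inter> ?C = {}" by (auto; presburger)+
  show "card (runners (k, l, m)) = k + l + m"
  proof -
    have c: "card ((\<lambda>i :: nat. 4 * i + r) ` {..<j}) = j" for r j using card_image[OF inj] by simp
    have "card (?A \<union> ?B \<union> ?C) = card (?A \<union> ?B) + card ?C" "card (?A \<union> ?B) = card ?A + card ?B"
      by (rule card_Un_disjoint; use d in simp)+
    then show ?thesis unfolding runners_def by (simp only: prod.case c)
  qed
  show "\<Sum>(runners (k, l, m)) = (\<Sum>i<k. 4 * i + 1) + (\<Sum>i<l. 4 * i + 2) + (\<Sum>i<m. 4 * i + 3)"
  proof -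
    have c: "\<Sum>((\<lambda>i :: nat. 4 * i + r) ` {..<j}) = (\<Sum>i<j. 4 * i + r)" for r j
      using sum.reindex[OF inj, of "\<lambda>x. x"] by (simp add: comp_def)
    have "\<Sum>(?A \<union> ?B \<union> ?C) = \<Sum>(?A \<union> ?B) + \<Sum>?C" "\<Sum>(?A \<union> ?B) = \<Sum>?A + \<Sum>?B"
      by (rule sum.union_disjoint; use d in simp)+
    then show ?thesis unfolding runners_def by (simp only: prod.case c)
  qed
qed

lemma even_consecutive: "even (x * (x - 1 :: int))" by (cases "even x") auto

text \<open>With c_0 = 0, and with c_1, c_2, c_3 beads on the other runners, let w_i = i + 4 c_i -
  (c_1 + c_2 + c_3) - 3/2 be the first free position of runner i, measured from the mean of the
  four positions. The coordinates used are p = (w_0 + w_1)/2, q = w_0 + w_2 and r = (w_0 + w_3)/2.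
  As the w_i have sum 0, the sum of their squares is 4 p^2 + q^2 + 4 r^2. The congruence
  conditions say that w_0, w_1, w_2, w_3 lie in consecutive residue classes modulo 4.\<close>

definition core_triples :: "int \<Rightarrow> (int \<times> int \<times> int) set" where
  "core_triples n = {(p, q, r). odd (p + r) \<and> 4 dvd 2 * r + q + 1 \<and> 4 * p\<^sup>2 + q\<^sup>2 + 4 * r\<^sup>2 = 8 * n + 5}"

text \<open>The three inequalities express that w_0 is the smallest of the four positions w_i,
  which corresponds to the emptiness of runner 0.\<close>

lemma card_cores_eq:
  "card (cores n) = card {(p, q, r) \<in> core_triples (int n). 2 * r + q < 0 \<and> p + r < 0 \<and> 2 * p + q < 0}"
proof -
  define D where "D = {(p, q, r) \<in> core_triples (int n). 2 * r + q < 0 \<and> p + r < 0 \<and> 2 * p + q < 0}"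
  \<comment> \<open>The size of the partition that belongs to an abacus with k, l, m beads.\<close>
  define T where "T = {(k, l, m). int n = 2 * ((int k)\<^sup>2 + (int l)\<^sup>2 + (int m)\<^sup>2) - int k + int m
     - (int (k + l + m) * (int (k + l + m) - 1)) div 2}"
  have size: "sum_list xs = n \<longleftrightarrow> (k, l, m) \<in> T" if p: "is_partition xs" and b: "beta_set xs = runners (k, l, m)" for xs k l m
  proof -
    have len: "length xs = k + l + m" using card_beta[OF p] by (simp add: b runners_card_sum)
    have half: "2 * ((int (k + l + m) * (int (k + l + m) - 1)) div 2) = int (k + l + m) * (int (k + l + m) - 1)"
      by (rule even_two_times_div_two[OF even_consecutive])
    have pm: "int (j * (j - 1)) = int j * (int j - 1)" for j
      by (cases j) (auto simp: algebra_simps)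
    have "int (2 * \<Sum>(beta_set xs)) = int (2 * sum_list xs + (k + l + m) * (k + l + m - 1))"
      by (simp only: sum_beta[OF p] len)
    also have "\<dots> = 2 * int (sum_list xs) + int ((k + l + m) * (k + l + m - 1))" by simp
    also have "\<dots> = 2 * int (sum_list xs) + int (k + l + m) * (int (k + l + m) - 1)"
      by (simp only: pm)
    also have "int (2 * \<Sum>(beta_set xs)) = 2 * int (\<Sum>(beta_set xs))" by simp
    finally have "2 * int (\<Sum>(beta_set xs)) = 2 * int (sum_list xs) + int (k + l + m) * (int (k + l + m) - 1)" .
    moreover have "2 * int (\<Sum>(beta_set xs)) = 4 * (int k * (int k - 1)) + 2 * int k + 4 * (int l * (int l - 1)) + 4 * int l
        + 4 * (int m * (int m - 1)) + 6 * int m"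
      unfolding b runners_card_sum(2) 
      using double_sum_progression[of 1 k] double_sum_progression[of 2 l] double_sum_progression[of 3 m] by simp
    ultimately have "2 * int (sum_list xs) = 2 * (2 * ((int k)\<^sup>2 + (int l)\<^sup>2 + (int m)\<^sup>2) - int k + int m
     - (int (k + l + m) * (int (k + l + m) - 1)) div 2)"
      using half by (simp add: power2_eq_square algebra_simps)
    then have "int (sum_list xs) = 2 * ((int k)\<^sup>2 + (int l)\<^sup>2 + (int m)\<^sup>2) - int k + int m
     - (int (k + l + m) * (int (k + l + m) - 1)) div 2"
      by (rule mult_left_cancel[THEN iffD1, rotated]) simp
    then show ?thesis unfolding T_def mem_Collect_eq prod.case by (metis of_nat_eq_iff)
  qed
  have "beta_set ` cores n = runners ` T"
  proof (intro equalityI subsetI)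
    fix X assume "X \<in> beta_set ` cores n"
    then obtain xs where xs: "is_partition xs" "is_core 4 xs" "sum_list xs = n" "X = beta_set xs" by (auto simp: cores_def)
    have "X \<in> range runners"
      using is_core_iff_closed[OF xs(1), of 4] xs zero_notin_beta finite_beta by (simp add: range_runners)
    then obtain k l m where "X = runners (k, l, m)" by auto
    then show "X \<in> runners ` T" using size[OF xs(1), of k l m] xs by auto
  next
    fix X assume "X \<in> runners ` T"
    then obtain k l m where X: "X = runners (k, l, m)" "(k, l, m) \<in> T" by auto
    then have R: "finite X" "0 \<notin> X" "\<forall>b\<in>X. 4 \<le> b \<longrightarrow> b - 4 \<in> X" using range_runners by blast+
    obtain xs where xs: "is_partition xs" "beta_set xs = X" using surj_beta[OF R(1,2)] .
    have "xs \<in> cores n"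
      using xs R(3) is_core_iff_closed[OF xs(1), of 4] size[OF xs(1), of k l m] X by (simp add: cores_def)
    then show "X \<in> beta_set ` cores n" using xs(2) by blast
  qed
  moreover have "card (beta_set ` cores n) = card (cores n)"
    by (rule card_image) (rule inj_on_subset[OF inj_beta], auto simp: cores_def)
  moreover have "card (runners ` T) = card T" by (rule card_image) (rule inj_on_subset[OF inj_runners], simp)
  \<comment> \<open>The inverse solves for k, l, m: the other positions exceed w_0 by 4 k + 1, 4 l + 2
    and 4 m + 3.\<close>
  moreover have "card T = card D"
  proof (rule bij_betw_same_card[OF bij_betw_byWitness[where 
        f = "\<lambda>(k, l, m). (int k - int l - int m - 1, 2 * int l - 2 * int k - 2 * int m - 1, int m - int k - int l)" 
        and f' = "\<lambda>(p, q, r). (nat (- ((2 * r + q + 1) div 4)), nat (- ((p + r + 1) div 2)), nat (- ((2 * p + q + 3) div 4)))"]])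
    let ?f = "\<lambda>(k, l, m). (int k - int l - int m - 1, 2 * int l - 2 * int k - 2 * int m - 1, int m - int k - int l)"
    let ?g = "\<lambda>(p, q, r). (nat (- ((2 * r + q + 1) div 4)), nat (- ((p + r + 1) div 2)), nat (- ((2 * p + q + 3) div 4)))"
    have norm: "4 * (int k - int l - int m - 1)\<^sup>2 + (2 * int l - 2 * int k - 2 * int m - 1)\<^sup>2 + 4 * (int m - int k - int l)\<^sup>2 = 8 * int n + 5
      \<longleftrightarrow> (k, l, m) \<in> T" for k l m
    proof -
      define h where "h = (int (k + l + m) * (int (k + l + m) - 1)) div 2"
      have half: "2 * h = int (k + l + m) * (int (k + l + m) - 1)" unfolding h_def
        by (rule even_two_times_div_two[OF even_consecutive])
      have T: "(k, l, m) \<in> T \<longleftrightarrow> int n = 2 * ((int k)\<^sup>2 + (int l)\<^sup>2 + (int m)\<^sup>2) - int k + int m - h"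
        by (simp add: T_def h_def)
      have "4 * (int k - int l - int m - 1)\<^sup>2 + (2 * int l - 2 * int k - 2 * int m - 1)\<^sup>2 + 4 * (int m - int k - int l)\<^sup>2
        = 8 * (2 * ((int k)\<^sup>2 + (int l)\<^sup>2 + (int m)\<^sup>2) - int k + int m) - 4 * (2 * h) + 5"
        unfolding half by (simp add: power2_eq_square algebra_simps)
      moreover have "X = 8 * Y - 4 * (2 * g) + 5 \<Longrightarrow> X = 8 * n' + 5 \<longleftrightarrow> n' = Y - g" for X Y g n' :: int
        by auto
      ultimately show ?thesis unfolding T by blast
    qed
    show "?f ` T \<subseteq> D"
    proof clarify
      fix k l m assume "(k, l, m) \<in> T"
      moreover have "2 * (int m - int k - int l) + (2 * int l - 2 * int k - 2 * int m - 1) + 1 = 4 * (- int k)" by simp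
      ultimately show "(int k - int l - int m - 1, 2 * int l - 2 * int k - 2 * int m - 1, int m - int k - int l) \<in> D"
        by (cases "even k"; cases "even l"; cases "even m") (simp_all add: D_def core_triples_def norm)
    qed
    have inv: "?f (?g x) = x" if x: "x \<in> D" for x
    proof -
      obtain p q r where x: "x = (p, q, r)" and h: "odd (p + r)" "4 dvd 2 * r + q + 1" "2 * r + q < 0" "p + r < 0" "2 * p + q < 0"
        using x by (auto simp: D_def core_triples_def)
      obtain k where k: "2 * r + q + 1 = 4 * k" using h(2) by (elim dvdE)
      have "even (p + r + 1)" using h(1) by simp
      then obtain l where l: "p + r + 1 = 2 * l" by (elim evenE)
      have q: "q = 4 * k - 2 * r - 1" and p: "p = 2 * l - r - 1" using k l by auto
      have m: "2 * p + q + 3 = 4 * (k + l - r)" by (simp add: p q)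
      have "k \<le> 0" using h(3) k by linarith
      moreover have "l \<le> 0" using h(4) l by linarith
      moreover have "k + l - r \<le> 0" using h(5) m by presburger
      ultimately
      show ?thesis by (simp only: x prod.case k l m) (simp add: p q)
    qed
    show "?g ` D \<subseteq> T"
    proof
      fix y assume "y \<in> ?g ` D"
      then obtain x where x: "x \<in> D" "y = ?g x" by blast
      obtain k l m where y: "y = (k, l, m)" by (cases y)
      have "(int k - int l - int m - 1, 2 * int l - 2 * int k - 2 * int m - 1, int m - int k - int l) = x"
        using inv[OF x(1)] unfolding x(2)[symmetric] y by simp
      then show "y \<in> T" using x(1) norm[of k l m] by (auto simp: y D_def core_triples_def)
    qed
    show "\<forall>x\<in>D. ?f (?g x) = x" using inv by blast
    show "\<forall>a\<in>T. ?g (?f a) = a" by (auto simp: algebra_simps)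
  qed
  ultimately show ?thesis by (simp add: D_def)
qed

definition odd_triples :: "int \<Rightarrow> (int \<times> int \<times> int) set" where
  "odd_triples M = {(q, y, z). odd q \<and> odd y \<and> odd z \<and> q\<^sup>2 + 2 * y\<^sup>2 + 2 * z\<^sup>2 = M}"

lemma finite_odd_triples: "finite (odd_triples M)"
proof (rule finite_subset)
  show "odd_triples M \<subseteq> {-M..M} \<times> {-M..M} \<times> {-M..M}"
  proof
    fix x assume "x \<in> odd_triples M"
    then obtain q y z where x: "x = (q, y, z)" and M: "q\<^sup>2 + 2 * y\<^sup>2 + 2 * z\<^sup>2 = M" by (auto simp: odd_triples_def)
    have "w \<in> {-M..M}" if "w \<in> {q, y, z}" for w
      by (rule abs_le_of_square_le) (use that in \<open>auto simp flip: M\<close>)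
    then show "x \<in> {-M..M} \<times> {-M..M} \<times> {-M..M}" unfolding x by (intro SigmaI) blast+
  qed
qed simp

definition argmin4 :: "int \<Rightarrow> int \<Rightarrow> int \<Rightarrow> int \<Rightarrow> int" where
  "argmin4 a b c d = (if a < b \<and> a < c \<and> a < d then 0 else if b < a \<and> b < c \<and> b < d then 1
     else if c < a \<and> c < b \<and> c < d then 2 else 3)"

lemma argmin4_rotate:
  assumes "distinct [a, b, c, d]"
  shows "[argmin4 b c d a = argmin4 a b c d + - 1] (mod 4)"
proof -
  have "a \<noteq> b" "a \<noteq> c" "a \<noteq> d" "b \<noteq> c" "b \<noteq> d" "c \<noteq> d" using assms by auto
  then consider "a < b" "a < c" "a < d" | "b < a" "b < c" "b < d" | "c < a" "c < b" "c < d" | "d < a" "d < b" "d < c"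
    by (metis linorder_neqE order.strict_trans)
  then show ?thesis by cases (simp_all add: argmin4_def cong_def)
qed

text \<open>Two symmetrisations remove the side conditions. Renaming the runners cyclically is the
  map (p, q, r) to (-r, -q, p), of order 4; it moves the index of the smallest position to a
  cyclically adjacent one, so that the restriction to w_0 being smallest costs a factor 4. The
  change of sign of q moves 2r + q + 1 from one class of even numbers modulo 4 to the other and
  costs a factor 2. Finally y = p + r and z = p - r.\<close>

lemma card_cores:
  "8 * card (cores n) = card (odd_triples (8 * int n + 5))"
proof -
  define S where "S = {(p, q, r). odd (p + r) \<and> odd q \<and> 4 * p\<^sup>2 + q\<^sup>2 + 4 * r\<^sup>2 = 8 * int n + 5}"
  have bij: "bij_betw (\<lambda>(p, q, r). (q, p + r, p - r)) S (odd_triples (8 * int n + 5))"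
  proof (rule bij_betw_byWitness[where f' = "\<lambda>(q, y, z). ((y + z) div 2, q, (y - z) div 2)"])
    have sq: "2 * (p + r)\<^sup>2 + 2 * (p - r)\<^sup>2 = 4 * p\<^sup>2 + 4 * r\<^sup>2" for p r :: int
      by (simp add: power2_eq_square algebra_simps)
    show "(\<lambda>(p, q, r). (q, p + r, p - r)) ` S \<subseteq> odd_triples (8 * int n + 5)"
      using sq by (auto simp: S_def odd_triples_def add.assoc) 
    have yz: "(y + z) div 2 + (y - z) div 2 = y \<and> (y + z) div 2 - (y - z) div 2 = z" if "odd y" "odd z" for y z :: int
      using that by presburger
    show "(\<lambda>(q, y, z). ((y + z) div 2, q, (y - z) div 2)) ` odd_triples (8 * int n + 5) \<subseteq> S"
    proof clarify
      fix q y z assume "(q, y, z) \<in> odd_triples (8 * int n + 5)"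
      then have h: "odd q" "odd y" "odd z" "q\<^sup>2 + 2 * y\<^sup>2 + 2 * z\<^sup>2 = 8 * int n + 5"
        by (auto simp: odd_triples_def)
      obtain p r where pr: "y = p + r" "z = p - r" using yz[OF h(2,3)] by metis
      then show "((y + z) div 2, q, (y - z) div 2) \<in> S"
        using h sq[of p r] by (simp add: S_def)
    qed
    show "\<forall>x\<in>odd_triples (8 * int n + 5). (case case x of (q, y, z) \<Rightarrow> ((y + z) div 2, q, (y - z) div 2) of
        (p, q, r) \<Rightarrow> (q, p + r, p - r)) = x"
      using yz by (auto simp: odd_triples_def)
  qed auto
  have finS: "finite S" using bij finite_odd_triples bij_betw_finite by blast
  define T where "T = core_triples (int n)"
  have TS: "T \<subseteq> S" unfolding T_def S_def core_triples_def by (auto; presburger)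
  have T: "(p, q, r) \<in> T \<longleftrightarrow> (p, q, r) \<in> S \<and> 4 dvd 2 * r + q + 1" for p q r
    using TS by (auto simp: T_def core_triples_def S_def)
  have 1: "card S = nat 2 * card {x \<in> S. [(\<lambda>(p, q, r). (2 * r + q + 1) div 2) x = 0] (mod 2)}"
  proof (rule card_eq_mult_card_fibre[where \<sigma> = "\<lambda>(p, q, r). (p, - q, r)" and c = 1])
    fix x assume "x \<in> S"
    then obtain p q r where x: "x = (p, q, r)" "odd q" by (auto simp: S_def)
    then have "[(2 * r - q + 1) div 2 = (2 * r + q + 1) div 2 + 1] (mod 2)"
      unfolding cong_iff_dvd_diff by presburger
    then show "[case case x of (p, q, r) \<Rightarrow> (p, - q, r) of (p, q, r) \<Rightarrow> (2 * r + q + 1) div 2 =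
        (case x of (p, q, r) \<Rightarrow> (2 * r + q + 1) div 2) + 1] (mod 2)" by (simp add: x(1))
  qed (auto simp: finS, auto simp: S_def inj_on_def)
  have "{x \<in> S. [(\<lambda>(p, q, r). (2 * r + q + 1) div 2) x = 0] (mod 2)} = T"
  proof -
    have "[(2 * r + q + 1) div 2 = 0] (mod 2) \<longleftrightarrow> 4 dvd 2 * r + q + 1" if "odd q" for q r :: int
      using that unfolding cong_iff_dvd_diff by presburger
    then show ?thesis using T by (fastforce simp: S_def)
  qed
  then have 1: "card S = 2 * card T" using 1 by simp
  define f where "f = (\<lambda>(p, q, r). argmin4 (2 * p + q + 2 * r) (2 * p - q - 2 * r) (q - 2 * p - 2 * r) (2 * r - 2 * p - q))"
  have 2: "card T = nat 4 * card {x \<in> T. [f x = 0] (mod 4)}"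
  proof (rule card_eq_mult_card_fibre[where \<sigma> = "\<lambda>(p, q, r). (- r, - q, p)" and c = "- 1"])
    show "finite T" using TS finS finite_subset by blast
    fix x assume x: "x \<in> T"
    then obtain p q r where x: "x = (p, q, r)" and h: "odd (p + r)" "odd q" "4 dvd 2 * r + q + 1" 
      "4 * p\<^sup>2 + q\<^sup>2 + 4 * r\<^sup>2 = 8 * int n + 5"
    proof -
      obtain p q r where pqr: "x = (p, q, r)" by (cases x)
      then have "(p, q, r) \<in> S" "4 dvd 2 * r + q + 1" using x T by auto
      then show ?thesis using that[OF pqr] by (simp add: S_def)
    qed
    have "4 dvd 2 * p - q + 1" "odd (p - r)" using h(1-3) by presburger+
    then show "(case x of (p, q, r) \<Rightarrow> (- r, - q, p)) \<in> T"
      using h by (simp add: x T_def core_triples_def)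
    have "distinct [2 * p + q + 2 * r, 2 * p - q - 2 * r, q - 2 * p - 2 * r, 2 * r - 2 * p - q]"
    proof -
      have "q \<noteq> 2 * w" for w using h(2) by auto
      from this[of p] this[of "- p"] this[of r] this[of "- r"]
      have "q \<noteq> 2 * p" "q + 2 * p \<noteq> 0" "q \<noteq> 2 * r" "q + 2 * r \<noteq> 0" by auto
      moreover have "p + r \<noteq> 0" using h(1) by (metis dvd_0_right)
      moreover have "p \<noteq> r" using h(1) by auto
      ultimately show ?thesis by auto
    qed
    from argmin4_rotate[OF this]
    show "[f (case x of (p, q, r) \<Rightarrow> (- r, - q, p)) = f x + - 1] (mod 4)"
      by (simp add: x f_def algebra_simps)
  qed (auto simp: inj_on_def)
  have "{x \<in> T. [f x = 0] (mod 4)} = {(p, q, r) \<in> core_triples (int n). 2 * r + q < 0 \<and> p + r < 0 \<and> 2 * p + q < 0}"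
  proof -
    have "[f (p, q, r) = 0] (mod 4) \<longleftrightarrow> 2 * r + q < 0 \<and> p + r < 0 \<and> 2 * p + q < 0" for p q r
      by (auto simp: f_def argmin4_def cong_def)
    then show ?thesis unfolding T_def by auto
  qed
  then have "card T = 4 * card (cores n)" using 2 card_cores_eq[of n] by simp
  then show ?thesis using 1 bij_betw_same_card[OF bij] by simp
qed

section \<open>Counting pairs of 4-cores by sums of six squares\<close>

text \<open>Both parities of s are admitted, because s and t will be half the sum and half the
  difference of two odd numbers, and either of these can be the even one.\<close>

definition sextuples_odd :: "int \<Rightarrow> (int \<times> int \<times> int \<times> int \<times> int \<times> int) set" where
  "sextuples_odd N = {(s, t, a, b, c, d). odd (s + t) \<and> odd a \<and> odd b \<and> odd c \<and> odd d \<and>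
     s\<^sup>2 + t\<^sup>2 + a\<^sup>2 + b\<^sup>2 + c\<^sup>2 + d\<^sup>2 = N}"

definition sextuples_even :: "int \<Rightarrow> (int \<times> int \<times> int \<times> int \<times> int \<times> int) set" where
  "sextuples_even N = {(s, t, a, b, c, d). odd (s + t) \<and> even a \<and> even b \<and> even c \<and> even d \<and>
     s\<^sup>2 + t\<^sup>2 + a\<^sup>2 + b\<^sup>2 + c\<^sup>2 + d\<^sup>2 = N}"

lemma finite_six_squares:
  "finite {(s, t, a, b, c, d). (s::int)\<^sup>2 + t\<^sup>2 + a\<^sup>2 + b\<^sup>2 + c\<^sup>2 + d\<^sup>2 = N}"
proof (rule finite_subset)
  let ?I = "{-N..N}"
  show "{(s, t, a, b, c, d). (s::int)\<^sup>2 + t\<^sup>2 + a\<^sup>2 + b\<^sup>2 + c\<^sup>2 + d\<^sup>2 = N}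
      \<subseteq> ?I \<times> ?I \<times> ?I \<times> ?I \<times> ?I \<times> ?I"
  proof
    fix x assume "x \<in> {(s, t, a, b, c, d). (s::int)\<^sup>2 + t\<^sup>2 + a\<^sup>2 + b\<^sup>2 + c\<^sup>2 + d\<^sup>2 = N}"
    then obtain s t a b c d where x: "x = (s, t, a, b, c, d)"
      and N: "s\<^sup>2 + t\<^sup>2 + a\<^sup>2 + b\<^sup>2 + c\<^sup>2 + d\<^sup>2 = N" by auto
    have "y \<in> ?I" if "y \<in> {s, t, a, b, c, d}" for y
      by (rule abs_le_of_square_le) (use that in \<open>auto simp flip: N\<close>)
    then show "x \<in> ?I \<times> ?I \<times> ?I \<times> ?I \<times> ?I \<times> ?I"
      unfolding x by (intro SigmaI) blast+
  qed
qed simp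

lemma finite_sextuples: "finite (sextuples_odd N)" "finite (sextuples_even N)"
proof -
  have "sextuples_odd N \<subseteq> {(s, t, a, b, c, d). s\<^sup>2 + t\<^sup>2 + a\<^sup>2 + b\<^sup>2 + c\<^sup>2 + d\<^sup>2 = N}"
    "sextuples_even N \<subseteq> {(s, t, a, b, c, d). s\<^sup>2 + t\<^sup>2 + a\<^sup>2 + b\<^sup>2 + c\<^sup>2 + d\<^sup>2 = N}"
    by (auto simp: sextuples_odd_def sextuples_even_def)
  then show "finite (sextuples_odd N)" "finite (sextuples_even N)"
    using finite_subset finite_six_squares by blast+
qed

lemma finite_cores: "finite (cores n)"
proof (rule finite_subset)
  show "cores n \<subseteq> fst ` core_pairs 4 n"
  proof
    fix xs assume "xs \<in> cores n"
    then have "(xs, []) \<in> core_pairs 4 n"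
      by (auto simp: cores_def core_pairs_def is_partition_def is_core_def ferrers_def)
    then show "xs \<in> fst ` core_pairs 4 n" by force
  qed
qed (simp add: finite_core_pairs)

lemma A4_eq_sum: "A\<^sub>4 n = (\<Sum>i\<le>n. card (cores i) * card (cores (n - i)))"
proof -
  have "bij_betw snd (SIGMA i:{..n}. cores i \<times> cores (n - i)) (core_pairs 4 n)"
    by (rule bij_betw_byWitness[where f' = "\<lambda>(xs, ys). (sum_list xs, xs, ys)"])
      (auto simp: cores_def core_pairs_def)
  then have "A\<^sub>4 n = card (SIGMA i:{..n}. cores i \<times> cores (n - i))"
    by (simp add: A\<^sub>4_def bij_betw_same_card)
  then show ?thesis by (simp add: finite_cores card_cartesian_product)
qed

lemma odd_square_mod_8: "odd (x :: int) \<Longrightarrow> \<exists>k\<ge>0. x\<^sup>2 = 8 * k + 1"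
proof -
  assume "odd x"
  then obtain m where m: "x = 2 * m + 1" by (elim oddE)
  have "even (m * (m + 1))" by simp
  then obtain k where k: "m * (m + 1) = 2 * k" by (elim evenE)
  have "x\<^sup>2 = 4 * (m * (m + 1)) + 1" unfolding m by (simp add: power2_eq_square algebra_simps)
  then have "x\<^sup>2 = 8 * k + 1" using k by simp
  moreover have "x\<^sup>2 \<ge> 0" by simp
  ultimately show ?thesis by (intro exI[of _ k]) linarith
qed

lemma odd_triple_norm:
  assumes "odd q" "odd y" "odd z"
  shows "\<exists>i. q\<^sup>2 + 2 * y\<^sup>2 + 2 * z\<^sup>2 = 8 * int i + 5"
proof -
  obtain a b c where "a \<ge> 0" "b \<ge> 0" "c \<ge> 0" "q\<^sup>2 = 8 * a + 1" "y\<^sup>2 = 8 * b + 1" "z\<^sup>2 = 8 * c + 1"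
    using odd_square_mod_8 assms by metis
  then show ?thesis by (intro exI[of _ "nat (a + 2 * b + 2 * c)"]) simp
qed

text \<open>The two odd squares with coefficient 1 are merged by q^2 + q'^2 = 2 s^2 + 2 t^2 with s
  = (q + q')/2 and t = (q - q')/2, after which the whole equation can be divided by 2. The size of
  the first core is recovered from the norm of its triple, which is 8 times the size plus
  5.\<close>

lemma A4_eq_card_sextuples_odd: "64 * A\<^sub>4 n = card (sextuples_odd (4 * int n + 5))"
proof -
  define T where "T i = odd_triples (8 * int i + 5)" for i
  have "64 * A\<^sub>4 n = (\<Sum>i\<le>n. (8 * card (cores i)) * (8 * card (cores (n - i))))"
    by (simp add: A4_eq_sum sum_distrib_left algebra_simps)
  also have "\<dots> = (\<Sum>i\<le>n. card (T i) * card (T (n - i)))"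
    by (simp only: card_cores T_def)
  also have "\<dots> = card (SIGMA i:{..n}. T i \<times> T (n - i))"
    by (simp add: T_def finite_odd_triples card_cartesian_product)
  also have "\<dots> = card (sextuples_odd (4 * int n + 5))"
  proof (rule bij_betw_same_card[OF bij_betw_byWitness[where 
      f = "\<lambda>(i, (q, y, z), (q', y', z')). ((q + q') div 2, (q - q') div 2, y, z, y', z')"
      and f' = "\<lambda>(s, t, y, z, y', z'). (nat (((s + t)\<^sup>2 + 2 * y\<^sup>2 + 2 * z\<^sup>2 - 5) div 8), (s + t, y, z), (s - t, y', z'))"]])
    let ?f = "\<lambda>(i :: nat, (q :: int, y :: int, z :: int), (q', y' :: int, z' :: int)). ((q + q') div 2, (q - q') div 2, y, z, y', z')"
    let ?g = "\<lambda>(s, t, y, z, y', z'). (nat (((s + t)\<^sup>2 + 2 * y\<^sup>2 + 2 * z\<^sup>2 - 5) div 8), (s + t, y, z), (s - t, y', z'))"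
    have f: "?f x \<in> sextuples_odd (4 * int n + 5) \<and> ?g (?f x) = x" if x: "x \<in> (SIGMA i:{..n}. T i \<times> T (n - i))" for x
    proof -
      obtain i q y z q' y' z' where x: "x = (i, (q, y, z), (q', y', z'))" and i: "i \<le> n"
        and h: "odd q" "odd y" "odd z" "q\<^sup>2 + 2 * y\<^sup>2 + 2 * z\<^sup>2 = 8 * int i + 5"
          "odd q'" "odd y'" "odd z'" "q'\<^sup>2 + 2 * y'\<^sup>2 + 2 * z'\<^sup>2 = 8 * int (n - i) + 5"
        using x by (auto simp: T_def odd_triples_def)
      have "even (q - q')" using h(1,5) by simp
      then obtain t where "q - q' = 2 * t" by (elim evenE)
      then have q: "q = 2 * t + q'" by simp
      have "2 * ((t + q')\<^sup>2 + t\<^sup>2 + y\<^sup>2 + z\<^sup>2 + y'\<^sup>2 + z'\<^sup>2) = (q\<^sup>2 + 2 * y\<^sup>2 + 2 * z\<^sup>2) + (q'\<^sup>2 + 2 * y'\<^sup>2 + 2 * z'\<^sup>2)"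
        unfolding q by (simp add: power2_eq_square algebra_simps)
      also have "\<dots> = 2 * (4 * int n + 5)" unfolding h(4,8) using i by (simp add: of_nat_diff)
      finally have N: "(t + q')\<^sup>2 + t\<^sup>2 + y\<^sup>2 + z\<^sup>2 + y'\<^sup>2 + z'\<^sup>2 = 4 * int n + 5" by simp
      have fx: "?f x = (t + q', t, y, z, y', z')" by (simp add: x q)
      have "?f x \<in> sextuples_odd (4 * int n + 5)" unfolding fx using N h by (simp add: sextuples_odd_def)
      moreover have "?g (?f x) = x" unfolding fx using h(4) by (simp add: x q add.commute)
      ultimately show ?thesis by blast
    qed
    have g: "?g x \<in> (SIGMA i:{..n}. T i \<times> T (n - i)) \<and> ?f (?g x) = x" if x: "x \<in> sextuples_odd (4 * int n + 5)" for x
    proof -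
      obtain s t y z y' z' where x: "x = (s, t, y, z, y', z')" and h: "odd (s + t)" "odd y" "odd z" "odd y'" "odd z'"
        "s\<^sup>2 + t\<^sup>2 + y\<^sup>2 + z\<^sup>2 + y'\<^sup>2 + z'\<^sup>2 = 4 * int n + 5"
        using x by (auto simp: sextuples_odd_def)
      have o: "odd (s - t)" using h(1) by simp
      obtain i where i: "(s + t)\<^sup>2 + 2 * y\<^sup>2 + 2 * z\<^sup>2 = 8 * int i + 5" using odd_triple_norm h by blast
      obtain i' where i': "(s - t)\<^sup>2 + 2 * y'\<^sup>2 + 2 * z'\<^sup>2 = 8 * int i' + 5" using odd_triple_norm o h by blast
      have "8 * int i + 5 + (8 * int i' + 5) = 2 * (s\<^sup>2 + t\<^sup>2 + y\<^sup>2 + z\<^sup>2 + y'\<^sup>2 + z'\<^sup>2)"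
        unfolding i[symmetric] i'[symmetric] by (simp add: power2_eq_square algebra_simps)
      then have n: "n = i + i'" unfolding h(6) by simp
      have gx: "?g x = (i, (s + t, y, z), (s - t, y', z'))" by (simp add: x i)
      have "?g x \<in> (SIGMA i:{..n}. T i \<times> T (n - i))"
        unfolding gx using h(1-5) o i i' by (simp add: n T_def odd_triples_def)
      moreover have "?f (?g x) = x" unfolding gx by (simp add: x)
      ultimately show ?thesis by blast
    qed
    show "\<forall>a\<in>(SIGMA i:{..n}. T i \<times> T (n - i)). ?g (?f a) = a" using f by (intro ballI) (rule conjunct2)
    show "\<forall>a\<in>sextuples_odd (4 * int n + 5). ?f (?g a) = a" using g by (intro ballI) (rule conjunct2)
    show "?f ` (SIGMA i:{..n}. T i \<times> T (n - i)) \<subseteq> sextuples_odd (4 * int n + 5)"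
      by (intro image_subsetI) (rule f[THEN conjunct1])
    show "?g ` sextuples_odd (4 * int n + 5) \<subseteq> (SIGMA i:{..n}. T i \<times> T (n - i))"
      by (intro image_subsetI) (rule g[THEN conjunct1])
  qed
  finally show ?thesis .
qed

section \<open>A theta series identity of Jacobi\<close>

text \<open>On odd numbers this is the nontrivial character modulo 4.\<close>

definition chi4 :: "int \<Rightarrow> int" where
  "chi4 w = (if [w = 1] (mod 4) then 1 else - 1)"

text \<open>On even numbers u this is (-1)^(u/2).\<close>

definition eta4 :: "int \<Rightarrow> int" where
  "eta4 u = (if 4 dvd u then 1 else - 1)"

text \<open>The condition on u - v only discards representations with K congruent to 5 modulo
  8.\<close>

definition ternary_reps :: "int \<Rightarrow> (int \<times> int \<times> int) set" where
  "ternary_reps K = {(p, u, v). odd p \<and> even u \<and> 4 dvd u - v \<and> p\<^sup>2 + u\<^sup>2 + v\<^sup>2 = K}"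

text \<open>Half of this is the coefficient of q^((K-1)/8) in phi(-q)^2 psi(q) = f_1^3, in the
  notation of Ramanujan.\<close>

definition ternary_coeff :: "int \<Rightarrow> int" where
  "ternary_coeff K = (\<Sum>(p, u, v)\<in>ternary_reps K. eta4 u)"

text \<open>Half of this is the coefficient of q^((L-1)/8) in the series of (-1)^n (2n + 1)
  q^(n(n+1)/2).\<close>

definition unary_coeff :: "int \<Rightarrow> int" where
  "unary_coeff L = (\<Sum>w\<in>{w. odd w \<and> w\<^sup>2 = L}. chi4 w * w)"

lemma finite_squares: "finite {w :: int. P w \<and> w\<^sup>2 = L}"
  by (rule finite_subset[of _ "{-L..L}"]) (use abs_le_of_square_le in \<open>auto\<close>)

lemma finite_ternary_reps: "finite (ternary_reps K)"
proof (rule finite_subset)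
  show "ternary_reps K \<subseteq> {-K..K} \<times> {-K..K} \<times> {-K..K}"
  proof
    fix x assume "x \<in> ternary_reps K"
    then obtain p u v where x: "x = (p, u, v)" and N: "p\<^sup>2 + u\<^sup>2 + v\<^sup>2 = K" by (auto simp: ternary_reps_def)
    have "y \<in> {-K..K}" if "y \<in> {p, u, v}" for y
      by (rule abs_le_of_square_le) (use that in \<open>auto simp flip: N\<close>)
    then show "x \<in> {-K..K} \<times> {-K..K} \<times> {-K..K}" unfolding x by (intro SigmaI) blast+
  qed
qed simp

lemma finite_four_squares:
  "finite {(a, b, c, d). (a::int)\<^sup>2 + b\<^sup>2 + c\<^sup>2 + d\<^sup>2 = N}"
proof (rule finite_subset)
  let ?I = "{-N..N}"
  show "{(a, b, c, d). (a::int)\<^sup>2 + b\<^sup>2 + c\<^sup>2 + d\<^sup>2 = N} \<subseteq> ?I \<times> ?I \<times> ?I \<times> ?I"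
  proof
    fix x assume "x \<in> {(a, b, c, d). (a::int)\<^sup>2 + b\<^sup>2 + c\<^sup>2 + d\<^sup>2 = N}"
    then obtain a b c d where x: "x = (a, b, c, d)"
      and N: "a\<^sup>2 + b\<^sup>2 + c\<^sup>2 + d\<^sup>2 = N" by auto
    have "y \<in> ?I" if "y \<in> {a, b, c, d}" for y
      by (rule abs_le_of_square_le) (use that in \<open>auto simp flip: N\<close>)
    then show "x \<in> ?I \<times> ?I \<times> ?I \<times> ?I"
      unfolding x by (intro SigmaI) blast+
  qed
qed simp

lemma eta4_minus: "eta4 (- u) = eta4 u" by (simp add: eta4_def)

lemma eta4_add: assumes "even c" "even d" shows "eta4 (c + d) = eta4 c * eta4 d"
  using assms unfolding eta4_def by (elim evenE) (simp; presburger)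

lemma chi4_odd_even: assumes "odd a" "even b" shows "chi4 (a - b) = chi4 a * eta4 b"
proof (cases "4 dvd b")
  case True
  then obtain d where "b = 4 * d" by (elim dvdE)
  then have "[a - b = 1] (mod 4) \<longleftrightarrow> [a = 1] (mod 4)" unfolding cong_iff_dvd_diff by presburger
  then show ?thesis using True by (simp add: chi4_def eta4_def)
next
  case False
  then have "b = 4 * (b div 4) + 2" using assms(2) by presburger
  then obtain d where "b = 4 * d + 2" ..
  then have "[a - b = 1] (mod 4) \<longleftrightarrow> \<not> [a = 1] (mod 4)"
    using assms(1) unfolding cong_iff_dvd_diff by presburger
  then show ?thesis using False by (simp add: chi4_def eta4_def)
qed

lemma chi4_minus: assumes "odd a" shows "chi4 (- a) = - chi4 a"
  using assms unfolding chi4_def cong_def by (elim oddE) (simp; presburger)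

text \<open>The sign is invariant under b to -b and under the permutations of b, c, d, and so the
  polynomial factor may be replaced by its average. Averaging over the sign of b turns it into a
  (c^2 + d^2 - 2 b^2), and the sum of this over the cyclic permutations of b, c, d is 0.\<close>

lemma odd_even_symmetric_sum:
  fixes T :: int
  defines "W \<equiv> {(a, b, c, d). odd a \<and> even b \<and> even c \<and> even d \<and> a\<^sup>2 + b\<^sup>2 + c\<^sup>2 + d\<^sup>2 = T}"
  shows "(\<Sum>(a, b, c, d)\<in>W. chi4 a * eta4 b * eta4 c * eta4 d * ((a - b) * (T - (a - b)\<^sup>2))) = 0"
proof -
  define g where "g = (\<lambda>(a, b, c, d). chi4 a * eta4 b * eta4 c * eta4 d)"
  have fin: "finite W" by (rule finite_subset[OF _ finite_four_squares[of T]]) (auto simp: W_def)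
  have reindex: "(\<Sum>x\<in>W. f x) = (\<Sum>x\<in>W. f (h x))"
    if "\<And>x. x \<in> W \<Longrightarrow> h x \<in> W" "\<And>x. x \<in> W \<Longrightarrow> h' x \<in> W" "\<And>x. h (h' x) = x" "\<And>x. h' (h x) = x"
    for f :: "_ \<Rightarrow> int" and h h' 
    by (rule sum.reindex_bij_witness[of _ h h']) (use that in auto)
  let ?S = "\<lambda>f. (\<Sum>x\<in>W. g x * f x)"
  have neg: "?S f = ?S (\<lambda>(a, b, c, d). f (a, - b, c, d))" for f
    by (subst reindex[of "\<lambda>(a, b, c, d). (a, - b, c, d)" "\<lambda>(a, b, c, d). (a, - b, c, d)"])
      (auto simp: W_def g_def eta4_minus intro!: sum.cong)
  have rot: "?S f = ?S (\<lambda>(a, b, c, d). f (a, c, d, b))" for f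
    by (subst reindex[of "\<lambda>(a, b, c, d). (a, c, d, b)" "\<lambda>(a, b, c, d). (a, d, b, c)"])
      (auto simp: W_def g_def algebra_simps intro!: sum.cong)
  define F where "F = (\<lambda>(a::int, b::int, c::int, d::int). (a - b) * (T - (a - b)\<^sup>2))"
  define E where "E = (\<lambda>(a::int, b::int, c::int, d::int). a * (c\<^sup>2 + d\<^sup>2 - 2 * b\<^sup>2) :: int)"
  have "2 * ?S F = ?S F + ?S (\<lambda>(a, b, c, d). F (a, - b, c, d))"
    using neg[of F] by simp
  also have "\<dots> = ?S (\<lambda>x. 2 * E x)"
    unfolding sum.distrib[symmetric]
    by (rule sum.cong) (auto simp: W_def F_def E_def algebra_simps power2_eq_square)
  also have "\<dots> = 2 * ?S E" by (simp add: sum_distrib_left algebra_simps)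
  finally have "?S F = ?S E" by simp
  moreover have "?S E = ?S (\<lambda>(a, b, c, d). E (a, c, d, b))" by (rule rot)
  moreover have "\<dots> = ?S (\<lambda>(a, b, c, d). E (a, d, b, c))"
    by (subst rot) (simp add: case_prod_unfold)
  moreover have "?S E + ?S (\<lambda>(a, b, c, d). E (a, c, d, b)) + ?S (\<lambda>(a, b, c, d). E (a, d, b, c)) = 0"
    unfolding sum.distrib[symmetric]
    by (rule sum.neutral) (auto simp: E_def algebra_simps)
  ultimately have "?S F = 0" by linarith
  then show ?thesis by (simp add: g_def F_def case_prod_unfold)
qed

text \<open>The orthogonal change of variables a = (p + w)/2, b = (p - w)/2, c = (u + v)/2, d = (u
  - v)/2 shows a symmetry that is invisible in the variables p, u, v, w: one of a, b is odd, the
  other three of the numbers are even, and the sign becomes a product of one factor for each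
  variable.\<close>

lemma jacobi_convolution:
  "(\<Sum>(x, w)\<in>{((p, u, v), w). odd p \<and> even u \<and> 4 dvd u - v \<and> odd w \<and> p\<^sup>2 + u\<^sup>2 + v\<^sup>2 + w\<^sup>2 = S}.
      eta4 (fst (snd x)) * chi4 w * w * (S - 2 * w\<^sup>2)) = 0"
proof -
  define Q where "Q = {((p::int, u::int, v::int), w::int). odd p \<and> even u \<and> 4 dvd u - v \<and> odd w \<and> p\<^sup>2 + u\<^sup>2 + v\<^sup>2 + w\<^sup>2 = S}"
  define W where "W T = {(a::int, b::int, c::int, d::int). odd a \<and> even b \<and> even c \<and> even d \<and> a\<^sup>2 + b\<^sup>2 + c\<^sup>2 + d\<^sup>2 = T}" for T
  define Q1 where "Q1 = {((p, u, v), w) \<in> Q. even ((p - w) div 2)}"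
  have fin: "finite Q"
  proof (rule finite_subset[OF _ finite_imageI[OF finite_four_squares[of S]]])
    show "Q \<subseteq> (\<lambda>(p, u, v, w). ((p, u, v), w)) ` {(a, b, c, d). a\<^sup>2 + b\<^sup>2 + c\<^sup>2 + d\<^sup>2 = S}"
      by (force simp: Q_def)
  qed
  define f where "f = (\<lambda>((p::int, u, v::int), w). eta4 u * chi4 w * w * (S - 2 * w\<^sup>2))"
  have minus: "f ((p, u, v), - w) = f ((p, u, v), w)" if "odd w" for p u v w
    using that by (simp add: f_def chi4_minus)
  have flip: "even ((p + w) div 2) \<longleftrightarrow> odd ((p - w) div 2)" if "odd p" "odd w" for p w :: int
    using that by presburger
  \<comment> \<open>The change of sign of w exchanges a and b, so it suffices to treat b even.\<close>
  have "sum f Q = sum f Q1 + sum f (Q - Q1)"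
    by (subst sum.subset_diff[of Q1 Q]) (use fin in \<open>auto simp: Q1_def\<close>)
  also have "sum f (Q - Q1) = sum f Q1"
    by (rule sum.reindex_bij_witness[of _ "\<lambda>((p, u, v), w). ((p, u, v), - w)" "\<lambda>((p, u, v), w). ((p, u, v), - w)"])
      (auto simp: Q1_def Q_def minus flip)
  also have "sum f Q1 = 0"
  proof (cases "even S")
    case False
    have "even S" if "((p, u, v), w) \<in> Q" for p u v w
    proof -
      have h: "odd p" "even u" "4 dvd u - v" "odd w" and S: "S = p\<^sup>2 + u\<^sup>2 + v\<^sup>2 + w\<^sup>2"
        using that by (auto simp: Q_def)
      have "even v" using h(2,3) by presburger
      then show ?thesis using h by (simp add: S)
    qed
    then have "Q1 = {}" using False by (auto simp: Q1_def)
    then show ?thesis by simp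
  next
    case True
    then obtain T where T: "S = 2 * T" by blast
    define g where "g = (\<lambda>(a, b, c, d). 2 * (chi4 a * eta4 b * eta4 c * eta4 d * ((a - b) * (T - (a - b)\<^sup>2))))"
    define i :: "int \<times> int \<times> int \<times> int \<Rightarrow> (int \<times> int \<times> int) \<times> int"
      where "i = (\<lambda>(a, b, c, d). ((a + b, c + d, c - d), a - b))"
    define j :: "(int \<times> int \<times> int) \<times> int \<Rightarrow> int \<times> int \<times> int \<times> int"
      where "j = (\<lambda>((p, u, v), w). ((p + w) div 2, (p - w) div 2, (u + v) div 2, (u - v) div 2))"
    have i: "i y \<in> Q1 \<and> j (i y) = y \<and> f (i y) = g y" if y: "y \<in> W T" for y
    proof -
      obtain a b c d where y: "y = (a, b, c, d)" and h: "odd a" "even b" "even c" "even d" 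
        "a\<^sup>2 + b\<^sup>2 + c\<^sup>2 + d\<^sup>2 = T" using y by (auto simp: W_def)
      have "4 dvd (c + d) - (c - d)" using h by (auto elim!: evenE)
      moreover have "(a + b)\<^sup>2 + (c + d)\<^sup>2 + (c - d)\<^sup>2 + (a - b)\<^sup>2 = S"
        unfolding T h(5)[symmetric] by (simp add: power2_eq_square algebra_simps)
      ultimately have "i y \<in> Q1" using h by (simp add: y i_def Q1_def Q_def)
      moreover have "f (i y) = g y" 
        using h by (simp add: y i_def g_def f_def eta4_add chi4_odd_even T algebra_simps)
      moreover have "j (i y) = y" by (simp add: y i_def j_def)
      ultimately show ?thesis by blast
    qed
    have j: "j x \<in> W T \<and> i (j x) = x" if x: "x \<in> Q1" for x
    proof -
      obtain p u v w where x: "x = ((p, u, v), w)" and h: "odd p" "even u" "4 dvd u - v" "odd w"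
        "p\<^sup>2 + u\<^sup>2 + v\<^sup>2 + w\<^sup>2 = S" "even ((p - w) div 2)" using x by (auto simp: Q1_def Q_def)
      have "4 dvd p - w" using h(1,4,6) by presburger
      then obtain b where b: "p - w = 4 * b" by (elim dvdE)
      obtain d where d: "u - v = 4 * d" using h(3) by (elim dvdE)
      obtain c where c: "u = 2 * c" using h(2) by blast
      have e: "p = w + 4 * b" "v = 2 * c - 4 * d" using b d c by auto
      have "(w + 2 * b)\<^sup>2 + (2 * b)\<^sup>2 + (2 * (c - d))\<^sup>2 + (2 * d)\<^sup>2 = T"
        using h(5) unfolding T e c by (simp add: power2_eq_square algebra_simps)
      moreover have "(p + w) div 2 = w + 2 * b" "(p - w) div 2 = 2 * b" "(u + v) div 2 = 2 * (c - d)"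
        "(u - v) div 2 = 2 * d"
        by (auto simp: e c)
      ultimately show ?thesis using h(4) by (simp add: x W_def i_def j_def) (simp add: e c)
    qed
    have "sum f Q1 = sum g (W T)"
    proof (rule sum.reindex_bij_witness[of _ i j])
      show "g (j x) = f x" if "x \<in> Q1" for x using i[of "j x"] j[OF that] by simp
    qed (use i j in blast)+
    also have "sum g (W T) = (\<Sum>(a, b, c, d)\<in>W T. 2 * (chi4 a * eta4 b * eta4 c * eta4 d * ((a - b) * (T - (a - b)\<^sup>2))))"
      by (simp add: g_def)
    also have "\<dots> = 2 * (\<Sum>(a, b, c, d)\<in>W T. chi4 a * eta4 b * eta4 c * eta4 d * ((a - b) * (T - (a - b)\<^sup>2)))"
      by (simp add: sum_distrib_left case_prod_unfold)
    also have "\<dots> = 0" using odd_even_symmetric_sum[of T] by (simp add: W_def)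
    finally show ?thesis .
  qed
  finally show ?thesis by (simp add: f_def Q_def case_prod_unfold)
qed

text \<open>For the generating functions U and V of the two coefficient sequences this is U' V = U
  V'.\<close>

lemma ternary_unary_convolution:
  "(\<Sum>K\<in>{0..S}. (2 * K - S) * (ternary_coeff K * unary_coeff (S - K))) = 0"
proof -
  define Q where "Q = {((p::int, u::int, v::int), w::int). odd p \<and> even u \<and> 4 dvd u - v \<and> odd w \<and> p\<^sup>2 + u\<^sup>2 + v\<^sup>2 + w\<^sup>2 = S}"
  define f where "f = (\<lambda>((p::int, u, v::int), w). eta4 u * chi4 w * w * (S - 2 * w\<^sup>2))"
  define q where "q L = {w :: int. odd w \<and> w\<^sup>2 = L}" for L
  have "sum f Q = (\<Sum>(K, x, w)\<in>(SIGMA K:{0..S}. ternary_reps K \<times> q (S - K)). f (x, w))"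
    by (rule sum.reindex_bij_witness[of _ "\<lambda>(K, x, w). (x, w)" "\<lambda>((p, u, v), w). (p\<^sup>2 + u\<^sup>2 + v\<^sup>2, (p, u, v), w)"])
      (auto simp: Q_def ternary_reps_def q_def algebra_simps)
  also have "\<dots> = (\<Sum>K\<in>{0..S}. \<Sum>(x, w)\<in>ternary_reps K \<times> q (S - K). f (x, w))"
    by (subst sum.Sigma) (auto simp: finite_ternary_reps finite_squares q_def case_prod_unfold)
  also have "\<dots> = (\<Sum>K\<in>{0..S}. (2 * K - S) * (ternary_coeff K * unary_coeff (S - K)))"
  proof (rule sum.cong[OF refl])
    fix K
    have "(2 * K - S) * (ternary_coeff K * unary_coeff (S - K))
      = (\<Sum>x\<in>ternary_reps K. \<Sum>w\<in>q (S - K). (2 * K - S) * (eta4 (fst (snd x)) * (chi4 w * w)))"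
      unfolding ternary_coeff_def unary_coeff_def q_def case_prod_unfold sum_product
      by (simp add: sum_distrib_left)
    also have "\<dots> = (\<Sum>x\<in>ternary_reps K. \<Sum>w\<in>q (S - K). f (x, w))"
      by (intro sum.cong refl) (auto simp: f_def q_def)
    finally show "(\<Sum>(x, w)\<in>ternary_reps K \<times> q (S - K). f (x, w)) = (2 * K - S) * (ternary_coeff K * unary_coeff (S - K))"
      by (simp add: sum.cartesian_product)
  qed
  finally show ?thesis using jacobi_convolution[of S] by (simp add: Q_def f_def case_prod_unfold)
qed

lemma odd_square_pos: "odd (w::int) \<Longrightarrow> w\<^sup>2 \<ge> 1"
  by (metis dvd_0_right int_one_le_iff_zero_less zero_less_power2)

lemma unary_coeff_nonpos: "L \<le> 0 \<Longrightarrow> unary_coeff L = 0"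
  unfolding unary_coeff_def by (rule sum.neutral) (use odd_square_pos in force)

lemma ternary_coeff_nonpos: "K \<le> 0 \<Longrightarrow> ternary_coeff K = 0"
proof -
  assume "K \<le> 0"
  have "ternary_reps K = {}"
  proof (rule equals0I)
    fix x assume "x \<in> ternary_reps K"
    then obtain p u v where "odd p" "p\<^sup>2 + u\<^sup>2 + v\<^sup>2 = K" by (auto simp: ternary_reps_def)
    then show False using odd_square_pos[of p] zero_le_power2[of u] zero_le_power2[of v] \<open>K \<le> 0\<close> by linarith
  qed
  then show ?thesis by (simp add: ternary_coeff_def)
qed

lemma unary_coeff_1: "unary_coeff 1 = 2"
proof -
  have "{w :: int. odd w \<and> w\<^sup>2 = 1} = {1, -1}" by (auto simp: power2_eq_1_iff)
  then show ?thesis by (simp add: unary_coeff_def chi4_def cong_def)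
qed

lemma ternary_coeff_1: "ternary_coeff 1 = 2"
proof -
  have "ternary_reps 1 = {(1, 0, 0), (-1, 0, 0)}"
  proof (intro equalityI subsetI)
    fix x assume "x \<in> ternary_reps 1"
    then obtain p u v where x: "x = (p, u, v)" "odd p" "p\<^sup>2 + u\<^sup>2 + v\<^sup>2 = 1" by (auto simp: ternary_reps_def)
    then have "u\<^sup>2 + v\<^sup>2 \<le> 0" using odd_square_pos[of p] by linarith
    then have "u = 0" "v = 0" by (simp_all add: sum_power2_le_zero_iff)
    then show "x \<in> {(1, 0, 0), (-1, 0, 0)}" using x by (simp add: power2_eq_1_iff)
  qed (auto simp: ternary_reps_def)
  then show ?thesis by (simp add: ternary_coeff_def eta4_def)
qed

text \<open>Jacobi's identity. The equation U' V = U V' determines each coefficient of the ternary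
  series from the earlier ones, and the unary series satisfies the same recursion, trivially, by
  antisymmetry.\<close>

lemma ternary_eq_unary: "ternary_coeff (int K) = unary_coeff (int K)"
proof (induction K rule: less_induct)
  case (less K)
  show ?case
  proof (cases "K \<le> 1")
    case True
    then have "K = 0 \<or> K = 1" by auto
    then show ?thesis
      using unary_coeff_nonpos[of 0] ternary_coeff_nonpos[of 0] unary_coeff_1 ternary_coeff_1 by auto
  next
    case False
    \<comment> \<open>The terms of the convolution of weight K + 1 are those up to K, and the one at K has the factor
      K - 1, which is nonzero here.\<close>
    define S where "S = int K + 1"
    define f where "f t L = (2 * L - S) * (t L * unary_coeff (S - L))" for t :: "int \<Rightarrow> int" and L
    have "sum (f unary_coeff) {0..S} = (\<Sum>L\<in>{0..S}. - f unary_coeff L)"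
      by (rule sum.reindex_bij_witness[of _ "\<lambda>L. S - L" "\<lambda>L. S - L"]) (auto simp: f_def algebra_simps)
    then have 1: "sum (f unary_coeff) {0..S} = 0" by (simp add: sum_negf)
    have 2: "sum (f ternary_coeff) {0..S} = 0"
      using ternary_unary_convolution[of S] by (simp add: f_def)
    have rest: "sum (f ternary_coeff) ({0..S} - {int K}) = sum (f unary_coeff) ({0..S} - {int K})"
    proof (rule sum.cong[OF refl])
      fix L assume L: "L \<in> {0..S} - {int K}"
      show "f ternary_coeff L = f unary_coeff L"
      proof (cases "L < int K")
        case True
        then have "nat L < K" "L \<ge> 0" using L by auto
        then show ?thesis using less.IH[of "nat L"] by (simp add: f_def)
      next
        case False
        then have "L = S" using L by (auto simp: S_def)
        then show ?thesis using unary_coeff_nonpos[of 0] by (simp add: f_def)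
      qed
    qed
    have K: "int K \<in> {0..S}" by (simp add: S_def)
    have "f ternary_coeff (int K) = f unary_coeff (int K)"
      using 1 2 rest sum.remove[OF _ K, of "f ternary_coeff"] sum.remove[OF _ K, of "f unary_coeff"] by simp
    then show ?thesis using False by (simp add: f_def S_def unary_coeff_1)
  qed
qed

text \<open>The unary sum is over the square roots of K. The sparsity of the series takes the
  place of complex multiplication: it is the reason why the cusp form has vanishing
  coefficients.\<close>

lemma ternary_coeff_nonsquare:
  assumes "ternary_coeff K \<noteq> 0"
  shows "\<exists>w. K = w\<^sup>2"
proof (rule ccontr)
  assume "\<nexists>w. K = w\<^sup>2"
  then have "{w. odd w \<and> w\<^sup>2 = K} = {}" by auto
  then have "unary_coeff K = 0" unfolding unary_coeff_def by (simp only: sum.empty)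
  moreover have "K > 0" using assms ternary_coeff_nonpos[of K] by linarith
  ultimately show False using assms ternary_eq_unary[of "nat K"] by simp
qed

section \<open>Parity classes of representations as six squares\<close>

text \<open>The left-hand side is, up to normalisation, a coefficient of the cusp form eta(4z)^6,
  the square of the cube in Jacobi's identity. The change of variables is the half-sum and
  half-difference in each of the three pairs.\<close>

lemma sum_eta4_sextuples_even:
  "(\<Sum>(s, t, a, b, c, d)\<in>sextuples_even N. eta4 (a + b + c + d))
    = (\<Sum>K\<in>{0..2 * N}. ternary_coeff K * ternary_coeff (2 * N - K))"
proof -
  define A where "A = (SIGMA K:{0..2 * N}. ternary_reps K \<times> ternary_reps (2 * N - K))"
  define f where "f = (\<lambda>(K :: int, x :: int \<times> int \<times> int, y :: int \<times> int \<times> int). eta4 (fst (snd x)) * eta4 (fst (snd y)))"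
  define g where "g = (\<lambda>(s :: int, t :: int, a, b, c, d). eta4 (a + b + c + d))"
  define i :: "int \<times> int \<times> int \<times> int \<times> int \<times> int \<Rightarrow> int \<times> (int \<times> int \<times> int) \<times> int \<times> int \<times> int"
    where "i = (\<lambda>(s, t, a, b, c, d). ((s + t)\<^sup>2 + (a + b)\<^sup>2 + (a - b)\<^sup>2, (s + t, a + b, a - b), (s - t, c + d, c - d)))"
  define j :: "int \<times> (int \<times> int \<times> int) \<times> int \<times> int \<times> int \<Rightarrow> int \<times> int \<times> int \<times> int \<times> int \<times> int"
    where "j = (\<lambda>(K, (p, u, v), (p', u', v')). ((p + p') div 2, (p - p') div 2, (u + v) div 2, (u - v) div 2,
       (u' + v') div 2, (u' - v') div 2))"
  have "(\<Sum>K\<in>{0..2 * N}. ternary_coeff K * ternary_coeff (2 * N - K)) =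
     (\<Sum>K\<in>{0..2 * N}. \<Sum>xy\<in>ternary_reps K \<times> ternary_reps (2 * N - K). f (K, xy))"
    unfolding ternary_coeff_def case_prod_unfold sum_product sum.cartesian_product
    by (simp add: f_def case_prod_unfold)
  also have "\<dots> = sum f A"
    unfolding A_def by (subst sum.Sigma) (auto simp: finite_ternary_reps case_prod_unfold)
  also have "\<dots> = sum g (sextuples_even N)"
  proof (rule sum.reindex_bij_witness[of _ i j])
    fix x assume "x \<in> A"
    then obtain K p u v p' u' v' where x: "x = (K, (p, u, v), (p', u', v'))"
      and h: "odd p" "even u" "4 dvd u - v" "p\<^sup>2 + u\<^sup>2 + v\<^sup>2 = K"
        "odd p'" "even u'" "4 dvd u' - v'" "p'\<^sup>2 + u'\<^sup>2 + v'\<^sup>2 = 2 * N - K"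
      by (auto simp: A_def ternary_reps_def)
    have "even (p - p')" using h(1,5) by simp
    then obtain s where s: "p - p' = 2 * s" by (elim evenE)
    obtain b where b: "u - v = 4 * b" using h(3) by (elim dvdE)
    obtain a where a: "u = 2 * a" using h(2) by (elim evenE)
    obtain d where d: "u' - v' = 4 * d" using h(7) by (elim dvdE)
    obtain c where c: "u' = 2 * c" using h(6) by (elim evenE)
    have e: "p = 2 * s + p'" "v = 2 * a - 4 * b" "v' = 2 * c - 4 * d" using s a b c d by auto
    have "2 * ((p' + s)\<^sup>2 + s\<^sup>2 + (2 * (a - b))\<^sup>2 + (2 * b)\<^sup>2 + (2 * (c - d))\<^sup>2 + (2 * d)\<^sup>2) = 2 * N"
      using h(4,8) unfolding e a c by (simp add: power2_eq_square algebra_simps)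
    then have N: "(p' + s)\<^sup>2 + s\<^sup>2 + (2 * (a - b))\<^sup>2 + (2 * b)\<^sup>2 + (2 * (c - d))\<^sup>2 + (2 * d)\<^sup>2 = N" by simp
    have jx: "j x = (p' + s, s, 2 * (a - b), 2 * b, 2 * (c - d), 2 * d)"
      by (auto simp: x j_def e a c)
    show "j x \<in> sextuples_even N" using N h(5) by (simp add: jx sextuples_even_def)
    show "i (j x) = x" unfolding jx using h(4) by (simp add: i_def x) (simp add: e a c)
    show "g (j x) = f x" unfolding jx by (simp add: x g_def f_def a c flip: eta4_add)
  next
    fix x assume "x \<in> sextuples_even N"
    then obtain s t a b c d where x: "x = (s, t, a, b, c, d)" and h: "odd (s + t)" "even a" "even b" "even c" "even d"
      "s\<^sup>2 + t\<^sup>2 + a\<^sup>2 + b\<^sup>2 + c\<^sup>2 + d\<^sup>2 = N" by (auto simp: sextuples_even_def)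
    have N: "(s + t)\<^sup>2 + (a + b)\<^sup>2 + (a - b)\<^sup>2 + ((s - t)\<^sup>2 + (c + d)\<^sup>2 + (c - d)\<^sup>2) = 2 * N"
      unfolding h(6)[symmetric] by (simp add: power2_eq_square algebra_simps)
    moreover have "(s - t)\<^sup>2 + (c + d)\<^sup>2 + (c - d)\<^sup>2 \<ge> 0" by simp
    then have "(s + t)\<^sup>2 + (a + b)\<^sup>2 + (a - b)\<^sup>2 \<le> 2 * N" using N by linarith
    moreover have "4 dvd (a + b) - (a - b)" "4 dvd (c + d) - (c - d)" using h by (auto elim!: evenE)
    ultimately show "i x \<in> A"
      using h(1-5) by (auto simp: x A_def i_def ternary_reps_def)
    show "j (i x) = x" by (simp add: x i_def j_def)
  qed
  finally show ?thesis by (simp add: g_def)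
qed

lemma card_sextuples_even_balanced:
  assumes N: "\<nexists>x y. 2 * N = x\<^sup>2 + (y::int)\<^sup>2"
  shows "card {(s, t, a, b, c, d) \<in> sextuples_even N. 4 dvd a + b + c + d}
       = card {(s, t, a, b, c, d) \<in> sextuples_even N. \<not> 4 dvd a + b + c + d}"
proof -
  define E where "E = {(s, t, a, b, c, d) \<in> sextuples_even N. 4 dvd a + b + c + d}"
  define O' where "O' = {(s, t, a, b, c, d) \<in> sextuples_even N. \<not> 4 dvd a + b + c + d}"
  have "ternary_coeff K * ternary_coeff (2 * N - K) = 0" for K
  proof (rule ccontr)
    assume "ternary_coeff K * ternary_coeff (2 * N - K) \<noteq> 0"
    then have nz: "ternary_coeff K \<noteq> 0" "ternary_coeff (2 * N - K) \<noteq> 0" by auto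
    obtain x where "K = x\<^sup>2" using ternary_coeff_nonsquare[OF nz(1)] by blast
    moreover obtain y where "2 * N - K = y\<^sup>2" using ternary_coeff_nonsquare[OF nz(2)] by blast
    ultimately have "2 * N = x\<^sup>2 + y\<^sup>2" by simp
    then show False using N by blast
  qed
  then have "(\<Sum>(s, t, a, b, c, d)\<in>sextuples_even N. eta4 (a + b + c + d)) = 0"
    unfolding sum_eta4_sextuples_even by (intro sum.neutral ballI)
  moreover have "sextuples_even N = E \<union> O'" "E \<inter> O' = {}" by (auto simp: E_def O'_def)
  moreover have "finite E" "finite O'"
    using finite_sextuples(2)[of N] by (auto simp: E_def O'_def intro: finite_subset[rotated])
  ultimately have "(\<Sum>(s, t, a, b, c, d)\<in>E. eta4 (a + b + c + d)) + (\<Sum>(s, t, a, b, c, d)\<in>O'. eta4 (a + b + c + d)) = 0"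
    by (simp add: sum.union_disjoint)
  moreover have "(\<Sum>(s, t, a, b, c, d)\<in>E. eta4 (a + b + c + d)) = (\<Sum>x\<in>E. 1)"
    by (rule sum.cong) (auto simp: E_def eta4_def)
  moreover have "(\<Sum>(s, t, a, b, c, d)\<in>O'. eta4 (a + b + c + d)) = (\<Sum>x\<in>O'. - 1)"
    by (rule sum.cong) (auto simp: O'_def eta4_def)
  ultimately show ?thesis by (simp add: E_def O'_def)
qed

text \<open>The last four entries undergo the reflection in (1, 1, 1, 1). It exchanges even and
  odd vectors among those whose sum is 2 modulo 4. Among the odd vectors these are one half, by a
  change of sign.\<close>

lemma card_sextuples_odd:
  "card (sextuples_odd N) = 2 * card {(s, t, a, b, c, d) \<in> sextuples_even N. \<not> 4 dvd a + b + c + d}"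
proof -
  define P where "P = {x \<in> sextuples_odd N. [(\<lambda>(s, t, a, b, c, d). (a + b + c + d) div 2) x = 1] (mod 2)}"
  have "card (sextuples_odd N) = nat 2 * card P" unfolding P_def
  proof (rule card_eq_mult_card_fibre[where \<sigma> = "\<lambda>(s, t, a, b, c, d). (s, t, - a, b, c, d)" and c = 1])
    fix x assume "x \<in> sextuples_odd N"
    then obtain s t a b c d where x: "x = (s, t, a, b, c, d)" "odd a" "odd b" "odd c" "odd d"
      by (auto simp: sextuples_odd_def)
    have "[(y - u) div 2 = (u + y) div 2 + 1] (mod 2)" if "odd u" "odd y" for u y :: int
      using that unfolding cong_iff_dvd_diff by presburger
    from this[of a "b + c + d"] x have "[(- a + b + c + d) div 2 = (a + b + c + d) div 2 + 1] (mod 2)"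
      by (simp add: algebra_simps)
    then show "[case case x of (s, t, a, b, c, d) \<Rightarrow> (s, t, - a, b, c, d) of (s, t, a, b, c, d) \<Rightarrow> (a + b + c + d) div 2 =
         (case x of (s, t, a, b, c, d) \<Rightarrow> (a + b + c + d) div 2) + 1] (mod 2)"
      by (simp add: x(1))
  qed (auto simp: finite_sextuples, auto simp: sextuples_odd_def inj_on_def)
  also have "card P = card {(s, t, a, b, c, d) \<in> sextuples_even N. \<not> 4 dvd a + b + c + d}"
  proof -
    define h :: "int \<times> int \<times> int \<times> int \<times> int \<times> int \<Rightarrow> int \<times> int \<times> int \<times> int \<times> int \<times> int"
      where "h = (\<lambda>(s, t, a, b, c, d). let m = (a + b + c + d) div 2 in (s, t, a - m, b - m, c - m, d - m))"
    have h: "\<exists>m. a + b + c + d = 2 * m \<and> odd m \<and> h (s, t, a, b, c, d) = (s, t, a - m, b - m, c - m, d - m)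
       \<and> h (h (s, t, a, b, c, d)) = (s, t, a, b, c, d)
       \<and> (a - m)\<^sup>2 + (b - m)\<^sup>2 + (c - m)\<^sup>2 + (d - m)\<^sup>2 = a\<^sup>2 + b\<^sup>2 + c\<^sup>2 + d\<^sup>2
       \<and> a - m + (b - m) + (c - m) + (d - m) = - (2 * m)"
      if "[a + b + c + d = 2] (mod 4)" for s t a b c d :: int
    proof -
      define m where "m = (a + b + c + d) div 2"
      have "x = 2 * (x div 2) \<and> odd (x div 2)" if "[x = 2] (mod 4)" for x :: int
        using that unfolding cong_iff_dvd_diff by presburger
      then have m: "a + b + c + d = 2 * m" "odd m" using that unfolding m_def by blast+
      have d: "d = 2 * m - a - b - c" using m(1) by simp
      show ?thesis
        by (rule exI[of _ m]) (use m(2) in \<open>simp add: h_def Let_def d power2_eq_square algebra_simps\<close>)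
    qed
    have P: "(s, t, a, b, c, d) \<in> P \<longleftrightarrow> (s, t, a, b, c, d) \<in> sextuples_odd N \<and> [a + b + c + d = 2] (mod 4)" for s t a b c d
    proof -
      have "[x div 2 = 1] (mod 2) \<longleftrightarrow> [x = 2] (mod 4)" if "even x" for x :: int
        using that unfolding cong_iff_dvd_diff by presburger
      from this[of "a + b + c + d"] show ?thesis by (auto simp: P_def sextuples_odd_def)
    qed
    define E where "E = {(s, t, a, b, c, d) \<in> sextuples_even N. \<not> 4 dvd a + b + c + d}"
    have E: "(s, t, a, b, c, d) \<in> E \<longleftrightarrow> (s, t, a, b, c, d) \<in> sextuples_even N \<and> [a + b + c + d = 2] (mod 4)" for s t a b c d
    proof -
      have "\<not> 4 dvd x \<longleftrightarrow> [x = 2] (mod 4)" if "even x" for x :: int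
        using that unfolding cong_iff_dvd_diff by presburger
      from this[of "a + b + c + d"] show ?thesis by (auto simp: E_def sextuples_even_def)
    qed
    have "bij_betw h P E"
    proof (rule bij_betw_byWitness[where f' = h])
      have neg: "[- (2 * m) = 2] (mod 4)" if "odd m" for m :: int
        using that unfolding cong_iff_dvd_diff by presburger
      have PE: "h x \<in> E \<and> h (h x) = x" if xP: "x \<in> P" for x
      proof -
        obtain s t a b c d where x: "x = (s, t, a, b, c, d)" by (cases x) auto
        have Px: "(s, t, a, b, c, d) \<in> sextuples_odd N" "[a + b + c + d = 2] (mod 4)" using xP P by (auto simp: x)
        obtain m where m: "odd m" "h x = (s, t, a - m, b - m, c - m, d - m)" "h (h x) = x"
          "(a - m)\<^sup>2 + (b - m)\<^sup>2 + (c - m)\<^sup>2 + (d - m)\<^sup>2 = a\<^sup>2 + b\<^sup>2 + c\<^sup>2 + d\<^sup>2"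
          "a - m + (b - m) + (c - m) + (d - m) = - (2 * m)"
          using h[OF Px(2), of s t] unfolding x by blast
        show ?thesis unfolding m(2) E using Px m neg by (auto simp: sextuples_odd_def sextuples_even_def)
      qed
      have EP: "h x \<in> P \<and> h (h x) = x" if xE: "x \<in> E" for x
      proof -
        obtain s t a b c d where x: "x = (s, t, a, b, c, d)" by (cases x) auto
        have Px: "(s, t, a, b, c, d) \<in> sextuples_even N" "[a + b + c + d = 2] (mod 4)" using xE E by (auto simp: x)
        obtain m where m: "odd m" "h x = (s, t, a - m, b - m, c - m, d - m)" "h (h x) = x"
          "(a - m)\<^sup>2 + (b - m)\<^sup>2 + (c - m)\<^sup>2 + (d - m)\<^sup>2 = a\<^sup>2 + b\<^sup>2 + c\<^sup>2 + d\<^sup>2"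
          "a - m + (b - m) + (c - m) + (d - m) = - (2 * m)"
          using h[OF Px(2), of s t] unfolding x by blast
        show ?thesis unfolding m(2) P using Px m neg by (auto simp: sextuples_odd_def sextuples_even_def)
      qed
      show "\<forall>a\<in>P. h (h a) = a" "h ` P \<subseteq> E" "\<forall>a'\<in>E. h (h a') = a'" "h ` E \<subseteq> P"
        using PE EP by blast+
    qed
    then show ?thesis unfolding E_def by (rule bij_betw_same_card)
  qed
  finally show ?thesis by simp
qed

text \<open>The symmetry is the left multiplication of the quaternion a + bi + cj + dk by (-1 + i
  + j + k)/2, a unit of order 3 of the Hurwitz order. It preserves the quaternions with even
  coefficients whose sum is divisible by 4, and it fixes only 0, which would make N a sum of two
  squares.\<close>

lemma three_dvd_card_sextuples_even:
  assumes N: "\<nexists>x y. N = x\<^sup>2 + (y::int)\<^sup>2"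
  shows "3 dvd card {(s, t, a, b, c, d) \<in> sextuples_even N. 4 dvd a + b + c + d}"
proof (rule three_dvd_card)
  let ?\<sigma> = "\<lambda>(s :: int, t :: int, a :: int, b :: int, c :: int, d :: int).
      (s, t, (- a - b - c - d) div 2, (a - b - c + d) div 2, (a + b - c - d) div 2, (a - b + c - d) div 2)"
  let ?S = "{(s, t, a, b, c, d) \<in> sextuples_even N. 4 dvd a + b + c + d}"
  show "finite ?S" using finite_sextuples(2)[of N] by (rule finite_subset[rotated]) auto
  have main: "?\<sigma> x \<in> ?S \<and> ?\<sigma> (?\<sigma> (?\<sigma> x)) = x \<and> ?\<sigma> x \<noteq> x" if xS: "x \<in> ?S" for x
  proof -
    obtain s t a b c d where x: "x = (s, t, 2 * a, 2 * b, 2 * c, d)"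
      and h: "odd (s + t)" "s\<^sup>2 + t\<^sup>2 + (2 * a)\<^sup>2 + (2 * b)\<^sup>2 + (2 * c)\<^sup>2 + d\<^sup>2 = N" "4 dvd 2 * a + 2 * b + 2 * c + d"
      using xS by (auto simp: sextuples_even_def elim!: evenE)
    obtain m where m: "2 * a + 2 * b + 2 * c + d = 4 * m" using h(3) by (elim dvdE)
    have d: "d = 4 * m - 2 * a - 2 * b - 2 * c" using m by simp
    have 1: "?\<sigma> x = (s, t, - (2 * m), 2 * (m - b - c), 2 * (a + b - m), 2 * (a + c - m))"
      by (auto simp: x d)
    have 2: "?\<sigma> (?\<sigma> x) = (s, t, 2 * (m - a), 2 * (c - m), 2 * (m - a - b - c), 2 * (b - m))"
      unfolding 1 by auto
    have 3: "?\<sigma> (?\<sigma> (?\<sigma> x)) = x" unfolding 2 by (auto simp: x d)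
    have "s\<^sup>2 + t\<^sup>2 + (- (2 * m))\<^sup>2 + (2 * (m - b - c))\<^sup>2 + (2 * (a + b - m))\<^sup>2 + (2 * (a + c - m))\<^sup>2 = N"
      unfolding h(2)[symmetric] d by (simp add: power2_eq_square algebra_simps)
    moreover have "- (2 * m) + 2 * (m - b - c) + 2 * (a + b - m) + 2 * (a + c - m) = 4 * (a - m)" by simp
    ultimately have 4: "?\<sigma> x \<in> ?S" unfolding 1 using h(1) by (simp add: sextuples_even_def)
    have 5: "?\<sigma> x \<noteq> x"
    proof
      assume "?\<sigma> x = x"
      then have "a = - m" "b = m - b - c" "c = a + b - m" "d = 2 * (a + c - m)"
        unfolding 1 by (auto simp: x)
      then have "a = - m" "c = b - 2 * m" "3 * b = 3 * m" "d = 2 * (a + c - m)" by auto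
      then have "a = - m" "b = m" "c = - m" "d = - 6 * m" by auto
      then have "m = 0" using d by auto
      then have "a = 0" "b = 0" "c = 0" "d = 0"
        using \<open>a = - m\<close> \<open>b = m\<close> \<open>c = - m\<close> \<open>d = - 6 * m\<close> by auto
      then show False using h(2) N by auto
    qed
    show ?thesis using 3 4 5 by blast
  qed
  show "\<And>x. x \<in> ?S \<Longrightarrow> ?\<sigma> x \<in> ?S" by (rule main[THEN conjunct1])
  show "\<And>x. x \<in> ?S \<Longrightarrow> ?\<sigma> (?\<sigma> (?\<sigma> x)) = x" by (rule main[THEN conjunct2, THEN conjunct1])
  show "\<And>x. x \<in> ?S \<Longrightarrow> ?\<sigma> x \<noteq> x" by (rule main[THEN conjunct2, THEN conjunct2])
qed

section \<open>Integer vectors and the neighbours of the cubic lattice at 3\<close>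

definition dot :: "('n::finite \<Rightarrow> int) \<Rightarrow> ('n \<Rightarrow> int) \<Rightarrow> int" where
  "dot x y = (\<Sum>i\<in>UNIV. x i * y i)"

lemma dot_commute: "dot x y = dot y x"
  by (simp add: dot_def mult.commute)

lemma dot_lin: "dot x (\<lambda>i. a * y i + b * z i) = a * dot x y + b * dot x z"
  by (simp add: dot_def algebra_simps sum.distrib sum_distrib_left)

lemma dot_self_lin: 
  "dot (\<lambda>i. a * x i + b * y i) (\<lambda>i. a * x i + b * y i)
    = a\<^sup>2 * dot x x + 2 * a * b * dot x y + b\<^sup>2 * dot y y"
  by (simp add: dot_def sum.distrib sum_distrib_left algebra_simps power2_eq_square)

lemma dot_self_nonneg: "dot r r \<ge> 0"
  unfolding dot_def by (intro sum_nonneg) simp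

lemma dot_self_eq_0: "dot r r = 0 \<longleftrightarrow> r = (\<lambda>_. 0)"
  unfolding dot_def by (subst sum_nonneg_eq_0_iff) (auto simp: fun_eq_iff)

lemma finite_dot_eq: "finite {v :: 'n::finite \<Rightarrow> int. dot v v = N}"
proof (rule finite_subset)
  show "{v :: 'n \<Rightarrow> int. dot v v = N} \<subseteq> Pi\<^sub>E UNIV (\<lambda>_. {-N..N})"
  proof (rule subsetI)
    fix v :: "'n \<Rightarrow> int" assume "v \<in> {v. dot v v = N}"
    then have v: "dot v v = N" by simp
    have "\<bar>v i\<bar> \<le> N" for i
    proof -
      have "v i * v i \<le> N" unfolding v[symmetric] dot_def
        by (rule member_le_sum) auto
      moreover have "\<bar>v i\<bar> \<le> v i * v i"
        using mult_right_mono[of 1 "\<bar>v i\<bar>" "\<bar>v i\<bar>"] by (cases "v i = 0") auto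
      ultimately show ?thesis by simp
    qed
    then have "v i \<in> {-N..N}" for i using abs_le_iff[of "v i" N] by auto
    then show "v \<in> Pi\<^sub>E UNIV (\<lambda>_. {-N..N})" by auto
  qed
  show "finite (Pi\<^sub>E (UNIV :: 'n set) (\<lambda>_. {-N..N}))" by (intro finite_PiE) auto
qed

lemma dot_cong:
  assumes "\<And>i. [x i = x' i] (mod m)" "\<And>i. [y i = y' i] (mod m)"
  shows "[dot x y = dot x' y'] (mod m)"
  unfolding dot_def by (intro cong_sum cong_mult assms)

text \<open>The representative of least absolute value modulo 3.\<close>

definition balanced_mod3 :: "int \<Rightarrow> int" where
  "balanced_mod3 x = (x + 1) mod 3 - 1"

lemma cong_balanced_mod3: "[balanced_mod3 x = x] (mod 3)"
  by (simp add: balanced_mod3_def cong_def mod_diff_left_eq)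

lemma balanced_mod3_range: "balanced_mod3 x \<in> {-1, 0, 1}"
  using pos_mod_bound[of 3 "x + 1"] pos_mod_sign[of 3 "x + 1"] unfolding balanced_mod3_def by (simp; linarith)

lemma balanced_mod3_eqI: "y \<in> {-1, 0, 1} \<Longrightarrow> [x = y] (mod 3) \<Longrightarrow> balanced_mod3 x = y"
proof -
  assume y: "y \<in> {-1, 0, 1}" and "[x = y] (mod 3)"
  then have "(x + 1) mod 3 = (y + 1) mod 3" by (metis cong_add cong_def cong_refl)
  then show ?thesis using y by (auto simp: balanced_mod3_def)
qed

text \<open>These are representatives of the vectors modulo 3.\<close>

definition sign_vectors :: "('n::finite \<Rightarrow> int) set" where
  "sign_vectors = {r. \<forall>i. r i \<in> {-1, 0, 1}}"

lemma sign_vectors_PiE: "sign_vectors = Pi\<^sub>E UNIV (\<lambda>_. {-1, 0, 1})"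
  by (auto simp: sign_vectors_def PiE_def)

lemma finite_sign_vectors: "finite sign_vectors"
  unfolding sign_vectors_PiE by (intro finite_PiE) auto

lemma card_sign_vectors: "card (sign_vectors :: ('n::finite \<Rightarrow> int) set) = 3 ^ CARD('n)"
  unfolding sign_vectors_PiE by (subst card_PiE) (auto simp: numeral_3_eq_3)

lemma sign_vectors_cong_eqI:
  assumes "x \<in> sign_vectors" "y \<in> sign_vectors" "\<And>i. [x i = y i] (mod 3)"
  shows "x = y"
proof
  fix i
  have "balanced_mod3 (x i) = x i" "balanced_mod3 (x i) = y i"
    using assms by (auto simp: sign_vectors_def intro!: balanced_mod3_eqI)
  then show "x i = y i" by simp
qed

lemma dot_self_sign_vector_le:
  assumes "r \<in> (sign_vectors :: ('n::finite \<Rightarrow> int) set)"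
  shows "dot r r \<le> int CARD('n)"
proof -
  have "r i * r i \<le> 1" for i
  proof -
    have "r i = -1 \<or> r i = 0 \<or> r i = 1" using assms by (auto simp: sign_vectors_def)
    then show ?thesis by auto
  qed
  then have "dot r r \<le> (\<Sum>i\<in>(UNIV :: 'n set). 1)" unfolding dot_def by (intro sum_mono)
  then show ?thesis by simp
qed

text \<open>Two translations modulo 3 give the count. Adding a unit vector at an index j where v
  does not vanish shifts the value of r . v, so a third of all vectors satisfy r . v = 1. On
  these, adding the isotropic vector v shifts r . r by 2, so a third of them is isotropic.\<close>

lemma card_isotropic_pairing_one:
  fixes v :: "'n::finite \<Rightarrow> int"
  assumes iso: "3 dvd dot v v" and nz: "\<not> 3 dvd v j"
  shows "9 * card {r \<in> sign_vectors. [dot r v = 1] (mod 3) \<and> 3 dvd dot r r} = 3 ^ CARD('n)"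
proof -
  define S where "S = {r \<in> sign_vectors. [dot r v = 1] (mod 3)}"
  have "card (sign_vectors :: ('n \<Rightarrow> int) set) = nat 3 * card {r \<in> sign_vectors. [dot r v = 1] (mod 3)}"
  proof (rule card_eq_mult_card_fibre[where \<sigma> = "\<lambda>r. r(j := balanced_mod3 (r j + 1))" and c = "v j"])
    fix r :: "'n \<Rightarrow> int" assume r: "r \<in> sign_vectors"
    show "r(j := balanced_mod3 (r j + 1)) \<in> sign_vectors"
      using r balanced_mod3_range[of "r j + 1"] by (auto simp: sign_vectors_def)
    have "[dot (r(j := balanced_mod3 (r j + 1))) v = dot (r(j := r j + 1)) v] (mod 3)"
      by (rule dot_cong) (auto simp: cong_balanced_mod3)
    also have "dot (r(j := r j + 1)) v = dot r v + v j"
    proof -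
      have "dot (r(j := r j + 1)) v = (\<Sum>i\<in>UNIV. r i * v i + (if i = j then v i else 0))"
        unfolding dot_def by (intro sum.cong) (auto simp: algebra_simps)
      then show ?thesis by (simp add: sum.distrib dot_def)
    qed
    finally show "[dot (r(j := balanced_mod3 (r j + 1))) v = dot r v + v j] (mod 3)" .
  next
    show "inj_on (\<lambda>r. r(j := balanced_mod3 (r j + 1))) sign_vectors"
    proof (rule inj_onI)
      fix x y :: "'n \<Rightarrow> int"
      assume xy: "x \<in> sign_vectors" "y \<in> sign_vectors" and eq: "x(j := balanced_mod3 (x j + 1)) = y(j := balanced_mod3 (y j + 1))"
      have "balanced_mod3 (x j + 1) = balanced_mod3 (y j + 1)" using fun_cong[OF eq, of j] by simp
      then have "[x j + 1 = y j + 1] (mod 3)"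
        using cong_balanced_mod3[of "x j + 1"] cong_balanced_mod3[of "y j + 1"] by (simp add: cong_def)
      then have "[x j = y j] (mod 3)" by (simp add: cong_add_rcancel)
      moreover have "x i = y i" if "i \<noteq> j" for i using fun_cong[OF eq, of i] that by simp
      ultimately show "x = y" using xy
        by (intro sign_vectors_cong_eqI) (metis cong_refl)+
    qed
    show "coprime (v j) 3"
      using prime_imp_coprime[of "3 :: int" "v j"] nz by (simp add: coprime_commute)
  qed (auto simp: finite_sign_vectors)
  moreover have "card S = nat 3 * card {r \<in> S. [dot r r = 0] (mod 3)}"
  proof (rule card_eq_mult_card_fibre[where \<sigma> = "\<lambda>r i. balanced_mod3 (r i + v i)" and c = 2])
    fix r assume r: "r \<in> S"
    have "[dot (\<lambda>i. balanced_mod3 (r i + v i)) v = dot (\<lambda>i. r i + v i) v] (mod 3)"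
      by (rule dot_cong) (auto simp: cong_balanced_mod3)
    also have "dot (\<lambda>i. r i + v i) v = dot r v + dot v v"
      by (simp add: dot_def sum.distrib algebra_simps)
    also have "[\<dots> = 1 + 0] (mod 3)"
      using r iso by (intro cong_add) (auto simp: S_def cong_0_iff)
    finally show "(\<lambda>i. balanced_mod3 (r i + v i)) \<in> S"
      using balanced_mod3_range by (auto simp: S_def sign_vectors_def)
    have "[dot (\<lambda>i. balanced_mod3 (r i + v i)) (\<lambda>i. balanced_mod3 (r i + v i)) = dot (\<lambda>i. r i + v i) (\<lambda>i. r i + v i)] (mod 3)"
      by (rule dot_cong) (auto simp: cong_balanced_mod3)
    also have "dot (\<lambda>i. r i + v i) (\<lambda>i. r i + v i) = dot r r + 2 * dot r v + dot v v"
      by (simp add: dot_def sum.distrib sum_distrib_left algebra_simps)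
    also have "[\<dots> = dot r r + 2 * 1 + 0] (mod 3)"
      using r iso by (intro cong_add cong_mult) (auto simp: S_def cong_0_iff)
    finally show "[dot (\<lambda>i. balanced_mod3 (r i + v i)) (\<lambda>i. balanced_mod3 (r i + v i)) = dot r r + 2] (mod 3)" by simp
  next
    show "inj_on (\<lambda>r i. balanced_mod3 (r i + v i)) S"
    proof (rule inj_onI)
      fix x y assume xy: "x \<in> S" "y \<in> S" and eq: "(\<lambda>i. balanced_mod3 (x i + v i)) = (\<lambda>i. balanced_mod3 (y i + v i))"
      have "[x i = y i] (mod 3)" for i
      proof -
        have "[x i + v i = y i + v i] (mod 3)"
          using fun_cong[OF eq, of i] cong_balanced_mod3[of "x i + v i"] cong_balanced_mod3[of "y i + v i"]
          by (simp add: cong_def)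
        then show ?thesis by (simp add: cong_add_rcancel)
      qed
      then show "x = y" using xy by (intro sign_vectors_cong_eqI) (auto simp: S_def)
    qed
  qed (auto simp: finite_sign_vectors S_def)
  ultimately show ?thesis
    by (simp add: S_def card_sign_vectors cong_0_iff conj_assoc)
qed

text \<open>This is where the dimension enters: it bounds the norm by 6, which leaves 3 and
  6.\<close>

lemma isotropic_sign_vector_6:
  fixes r :: "'n::finite \<Rightarrow> int"
  assumes "CARD('n) = 6" "r \<in> sign_vectors" "3 dvd dot r r" "r \<noteq> (\<lambda>_. 0)"
  obtains k where "dot r r = 3 * k" "k = 1 \<or> k = 2"
proof -
  obtain k where k: "dot r r = 3 * k" using assms(3) by auto
  have "dot r r > 0" using dot_self_nonneg[of r] dot_self_eq_0[of r] assms(4) by linarith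
  moreover have "dot r r \<le> 6" using dot_self_sign_vector_le[OF assms(2)] assms(1) by simp
  ultimately have "k = 1 \<or> k = 2" using k by linarith
  then show ?thesis using k that by blast
qed

text \<open>Three times the reflection in r, for r . r = 3 or r . r = 6. The factor 3 makes it
  integral.\<close>

definition scaled_reflection :: "('n::finite \<Rightarrow> int) \<Rightarrow> ('n \<Rightarrow> int) \<Rightarrow> 'n \<Rightarrow> int" where
  "scaled_reflection r v = (\<lambda>i. 3 * v i - (6 div dot r r) * dot r v * r i)"

text \<open>The inverse of the neighbour construction must recover r from z, which is (r . r / 3)
  r modulo 3 by scaled_reflection_cong. For r . r = 6 the factor is 2, that is -1, whence the
  sign.\<close>

definition isotropic_root :: "('n::finite \<Rightarrow> int) \<Rightarrow> 'n \<Rightarrow> int" where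
  "isotropic_root z = (let \<rho> = (\<lambda>i. balanced_mod3 (z i)) in if dot \<rho> \<rho> = 3 then \<rho> else (\<lambda>i. - \<rho> i))"

lemma norm_scaled_reflection:
  assumes "dot r r = 3 \<or> dot r r = 6"
  shows "dot (scaled_reflection r v) (scaled_reflection r v) = 9 * dot v v"
    "dot r (scaled_reflection r v) = - 3 * dot r v"
    "scaled_reflection r (scaled_reflection r v) = (\<lambda>i. 9 * v i)"
proof -
  define k where "k = 6 div dot r r"
  have k: "k * dot r r = 6" using assms by (auto simp: k_def)
  have s: "scaled_reflection r v = (\<lambda>i. 3 * v i + (- k * dot r v) * r i)"
    by (simp add: scaled_reflection_def k_def)
  have "dot (scaled_reflection r v) (scaled_reflection r v)
      = 9 * dot v v - 6 * k * (dot r v)\<^sup>2 + k * (k * dot r r) * (dot r v)\<^sup>2"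
    unfolding s dot_self_lin by (simp add: dot_commute[of v r] power2_eq_square algebra_simps)
  then show "dot (scaled_reflection r v) (scaled_reflection r v) = 9 * dot v v"
    by (simp add: k)
  have "dot r (scaled_reflection r v) = 3 * dot r v - (k * dot r r) * dot r v"
    unfolding s dot_lin by simp
  then show d: "dot r (scaled_reflection r v) = - 3 * dot r v" by (simp add: k)
  show "scaled_reflection r (scaled_reflection r v) = (\<lambda>i. 9 * v i)"
    unfolding scaled_reflection_def[of r "scaled_reflection r v"] d
    by (auto simp: scaled_reflection_def fun_eq_iff)
qed

text \<open>A vector that is not orthogonal to r modulo 3 is mapped to a vector that determines r:
  its class modulo 3 spans the same line. The normalisation r . v = 1 selects one of r and
  -r.\<close>

lemma scaled_reflection_cong:
  fixes r :: "'n::finite \<Rightarrow> int"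
  assumes "dot r r = 3 * t" "t = 1 \<or> t = 2" "[dot r v = 1] (mod 3)"
  shows "[scaled_reflection r v i = t * r i] (mod 3)"
proof -
  obtain m where m: "dot r v = 1 + 3 * m" using assms(3) 
    by (metis cong_iff_lin mult.commute cong_sym)
  have "t * r i - scaled_reflection r v i = 3 * (if t = 1 then r i + 2 * m * r i - v i else r i + m * r i - v i)"
    using assms(2) by (auto simp: scaled_reflection_def assms(1) m algebra_simps)
  then show ?thesis by (metis cong_iff_dvd_diff cong_sym dvd_triv_left)
qed

lemma isotropic_root_eqI:
  fixes r :: "'n::finite \<Rightarrow> int"
  assumes "r \<in> sign_vectors" "dot r r = 3 * t" "t = 1 \<or> t = 2" "\<And>i. [z i = t * r i] (mod 3)"
  shows "isotropic_root z = r"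
proof (cases "t = 1")
  case True
  then have "(\<lambda>i. balanced_mod3 (z i)) = r" using assms by (auto simp: sign_vectors_def intro!: balanced_mod3_eqI)
  then show ?thesis using assms True by (simp add: isotropic_root_def)
next
  case False
  then have t: "t = 2" using assms by simp
  have "balanced_mod3 (z i) = - r i" for i
  proof (rule balanced_mod3_eqI)
    show "- r i \<in> {-1, 0, 1}" using assms(1) by (auto simp: sign_vectors_def)
    show "[z i = - r i] (mod 3)"
      using assms(4)[of i] unfolding t cong_iff_dvd_diff by presburger
  qed
  then have "(\<lambda>i. balanced_mod3 (z i)) = (\<lambda>i. - r i)" by simp
  moreover have "dot (\<lambda>i. - r i) (\<lambda>i. - r i) = dot r r" by (simp add: dot_def)
  ultimately show ?thesis using assms t by (simp add: isotropic_root_def)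
qed

text \<open>Writing z = t r + 3 w, the norm condition modulo 9 determines r . w modulo 3; this
  makes the reflected vector divisible by 9 in the next lemma.\<close>

lemma isotropic_root_props:
  fixes z :: "'n::finite \<Rightarrow> int"
  assumes card: "CARD('n) = 6" and z: "dot z z = 9 * N" and nz: "\<not> 3 dvd z j"
  defines "r \<equiv> isotropic_root z"
  obtains t where "r \<in> sign_vectors" "dot r r = 3 * t" "t = 1 \<or> t = 2" "\<And>i. [z i = t * r i] (mod 3)"
    "[dot r z = 6] (mod 9)"
proof -
  define \<rho> where "\<rho> = (\<lambda>i. balanced_mod3 (z i))"
  have \<rho>: "\<rho> \<in> sign_vectors" using balanced_mod3_range by (auto simp: \<rho>_def sign_vectors_def)
  have "[dot \<rho> \<rho> = dot z z] (mod 3)" by (rule dot_cong) (auto simp: \<rho>_def cong_balanced_mod3)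
  moreover have "3 dvd 9 * N" by (rule dvd_mult2) simp
  ultimately have "3 dvd dot \<rho> \<rho>" unfolding z by (simp add: cong_dvd_iff)
  moreover have "\<rho> \<noteq> (\<lambda>_. 0)"
  proof
    assume "\<rho> = (\<lambda>_. 0)"
    then have "balanced_mod3 (z j) = 0" by (simp add: \<rho>_def fun_eq_iff)
    then show False using cong_balanced_mod3[of "z j"] nz by (simp add: cong_def dvd_eq_mod_eq_0)
  qed
  ultimately obtain t where t: "dot \<rho> \<rho> = 3 * t" "t = 1 \<or> t = 2"
    using isotropic_sign_vector_6[OF card \<rho>] by blast
  have r: "r = (\<lambda>i. (if t = 1 then 1 else -1) * \<rho> i)"
    unfolding r_def isotropic_root_def \<rho>_def[symmetric] Let_def using t by auto
  have rs: "r \<in> sign_vectors" using \<rho> by (auto simp: r sign_vectors_def)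
  have rr: "dot r r = 3 * t" using t by (auto simp: r dot_def)
  have zr: "[z i = t * r i] (mod 3)" for i
  proof -
    have "3 dvd z i - \<rho> i" using cong_balanced_mod3[of "z i"] by (simp add: \<rho>_def cong_iff_dvd_diff dvd_diff_commute)
    then show ?thesis unfolding cong_iff_dvd_diff r using t(2) by (auto; presburger)
  qed
  define w where "w = (\<lambda>i. (z i - t * r i) div 3)"
  have zw: "z = (\<lambda>i. t * r i + 3 * w i)"
    using zr by (auto simp: w_def cong_iff_dvd_diff)
  have 1: "9 * N = t\<^sup>2 * (3 * t) + 6 * t * dot r w + 9 * dot w w"
    using z unfolding zw dot_self_lin rr by simp
  have 2: "dot r z = t * (3 * t) + 3 * dot r w" unfolding zw dot_lin rr by simp
  have "[dot r z = 6] (mod 9)"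
  proof -
    define A B where "A = dot r w" and "B = dot w w"
    have "9 * N = t * t * (3 * t) + 6 * t * A + 9 * B" "dot r z = t * (3 * t) + 3 * A"
      using 1 2 by (simp_all add: A_def B_def power2_eq_square)
    then show ?thesis
      using t(2) unfolding cong_iff_dvd_diff by (elim disjE) (simp; presburger)+
  qed
  then show ?thesis using that rs rr t(2) zr by blast
qed

text \<open>The neighbour of the lattice along the isotropic line of r is the image of the lattice
  under the reflection in r. The vectors of norm N in it that lie outside the original lattice
  are, after scaling by 3, the primitive vectors of norm 9N on that line modulo 3, and each of
  these belongs to exactly one neighbour. Each primitive v of norm N contributes 3^6 / 9 = 81
  lines, whereas a vector divisible by 3 contributes none.\<close>

lemma card_primitive_norm_9:
  fixes N :: int
  assumes card: "CARD('n::finite) = 6" and N: "3 dvd N"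
  shows "card {z :: 'n \<Rightarrow> int. dot z z = 9 * N \<and> (\<exists>i. \<not> 3 dvd z i)}
    = 81 * card {v :: 'n \<Rightarrow> int. dot v v = N \<and> (\<exists>i. \<not> 3 dvd v i)}"
proof -
  define R where "R v = {r \<in> (sign_vectors :: ('n \<Rightarrow> int) set). [dot r v = 1] (mod 3) \<and> 3 dvd dot r r}" for v
  define V where "V = {v :: 'n \<Rightarrow> int. dot v v = N}"
  define Z where "Z = {z :: 'n \<Rightarrow> int. dot z z = 9 * N \<and> (\<exists>i. \<not> 3 dvd z i)}"
  have R: "\<exists>t. dot r r = 3 * t \<and> (t = 1 \<or> t = 2)" if "r \<in> R v" for r v
  proof -
    have "r \<noteq> (\<lambda>_. 0)"
    proof
      assume "r = (\<lambda>_. 0)"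
      then show False using that by (simp add: R_def dot_def cong_def)
    qed
    then show ?thesis using isotropic_sign_vector_6[OF card, of r] that by (auto simp: R_def)
  qed
  have "bij_betw (\<lambda>(v, r). scaled_reflection r v) (SIGMA v:V. R v) Z"
  proof (rule bij_betw_byWitness[where f' = "\<lambda>z. 
      (\<lambda>i. scaled_reflection (isotropic_root z) z i div 9, isotropic_root z)"])
    show "\<forall>a\<in>(SIGMA v:V. R v). (\<lambda>z. (\<lambda>i. scaled_reflection (isotropic_root z) z i div 9, isotropic_root z))
        ((\<lambda>(v, r). scaled_reflection r v) a) = a"
    proof
      fix a assume "a \<in> (SIGMA v:V. R v)"
      then obtain v r where a: "a = (v, r)" and vr: "v \<in> V" "r \<in> R v" by blast
      then obtain t where t: "dot r r = 3 * t" "t = 1 \<or> t = 2" using R by blast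
      have "isotropic_root (scaled_reflection r v) = r"
        using vr t by (intro isotropic_root_eqI[of _ t] scaled_reflection_cong) (auto simp: R_def)
      moreover have "scaled_reflection r (scaled_reflection r v) = (\<lambda>i. 9 * v i)"
        using t by (intro norm_scaled_reflection) auto
      ultimately show "(\<lambda>z. (\<lambda>i. scaled_reflection (isotropic_root z) z i div 9, isotropic_root z))
        ((\<lambda>(v, r). scaled_reflection r v) a) = a"
        by (simp add: a)
    qed
    \<comment> \<open>Dividing by 9 and not by 3, because the argument is itself three times a vector of the neighbour.\<close>
    have *: "scaled_reflection (isotropic_root z) (\<lambda>i. scaled_reflection (isotropic_root z) z i div 9) = z
        \<and> (\<lambda>i. scaled_reflection (isotropic_root z) z i div 9) \<in> V
        \<and> isotropic_root z \<in> R (\<lambda>i. scaled_reflection (isotropic_root z) z i div 9)" if zZ: "z \<in> Z" for z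
    proof -
      obtain j where z: "dot z z = 9 * N" and j: "\<not> 3 dvd z j" using zZ by (auto simp: Z_def)
      define r where "r = isotropic_root z"
      define v where "v = (\<lambda>i. scaled_reflection r z i div 9)"
      obtain t where t: "r \<in> sign_vectors" "dot r r = 3 * t" "t = 1 \<or> t = 2" "\<And>i. [z i = t * r i] (mod 3)"
        "[dot r z = 6] (mod 9)"
        using isotropic_root_props[OF card z j] unfolding r_def by blast
      have r36: "dot r r = 3 \<or> dot r r = 6" using t by auto
      have "9 dvd scaled_reflection r z i" for i
      proof -
        obtain a where a: "z i = t * r i + 3 * a"
          using t(4)[of i] by (metis cong_iff_lin cong_sym mult.commute)
        obtain b where b: "dot r z = 6 + 9 * b"
          using t(5) by (metis cong_iff_lin cong_sym mult.commute)
        have "scaled_reflection r z i = 9 * (if t = 1 then a - r i - 2 * b * r i else a - b * r i)"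
          using t(3) by (auto simp: scaled_reflection_def t(2) a b algebra_simps)
        then show ?thesis by simp
      qed
      then have v9: "scaled_reflection r z = (\<lambda>i. 9 * v i)" by (simp add: v_def)
      have "dot (\<lambda>i. 9 * v i) (\<lambda>i. 9 * v i) = 81 * dot v v"
        using dot_self_lin[of 9 v 0 v] by simp
      then have vN: "dot v v = N" using norm_scaled_reflection(1)[OF r36, of z] z by (simp add: v9)
      have r9: "dot r (\<lambda>i. 9 * v i) = 9 * dot r v"
        by (simp add: dot_def sum_distrib_left algebra_simps)
      then have "9 * dot r v = - 3 * dot r z" using norm_scaled_reflection(2)[OF r36, of z] by (simp add: v9)
      then have rv: "[dot r v = 1] (mod 3)" using t(5) unfolding cong_iff_dvd_diff by presburger
      have "scaled_reflection r (\<lambda>i. 9 * v i) = (\<lambda>i. 9 * scaled_reflection r v i)"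
        unfolding scaled_reflection_def r9 by (simp add: algebra_simps)
      then have "scaled_reflection r v = z"
        using norm_scaled_reflection(3)[OF r36, of z] by (simp add: v9 fun_eq_iff)
      then show ?thesis using vN rv t(1,2) by (simp add: V_def R_def r_def[symmetric] v_def[symmetric])
    qed
    show "\<forall>a'\<in>Z. (case (\<lambda>i. scaled_reflection (isotropic_root a') a' i div 9, isotropic_root a')
        of (v, r) \<Rightarrow> scaled_reflection r v) = a'" using * by simp
    show "(\<lambda>z. (\<lambda>i. scaled_reflection (isotropic_root z) z i div 9, isotropic_root z)) ` Z \<subseteq> (SIGMA v:V. R v)"
      using * by auto
    show "(\<lambda>(v, r). scaled_reflection r v) ` (SIGMA v:V. R v) \<subseteq> Z"
    proof clarify
      fix v r assume vr: "v \<in> V" "r \<in> R v"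
      then obtain t where t: "dot r r = 3 * t" "t = 1 \<or> t = 2" using R by blast
      then have "r \<noteq> (\<lambda>_. 0)" using dot_self_eq_0[of r] by auto
      then obtain i where "r i \<noteq> 0" by auto
      moreover have "r i \<in> {-1, 0, 1}" using vr(2) by (simp add: R_def sign_vectors_def)
      ultimately have "\<not> 3 dvd t * r i" using t(2) by auto
      moreover have "[scaled_reflection r v i = t * r i] (mod 3)"
        using vr t by (intro scaled_reflection_cong) (auto simp: R_def)
      ultimately have "\<not> 3 dvd scaled_reflection r v i" using cong_dvd_iff by blast
      then show "scaled_reflection r v \<in> Z"
        using norm_scaled_reflection(1)[of r v] t vr by (auto simp: Z_def V_def)
    qed
  qed
  then have "card Z = card (SIGMA v:V. R v)" by (simp add: bij_betw_same_card)
  also have "\<dots> = (\<Sum>v\<in>V. card (R v))"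
    using finite_dot_eq finite_sign_vectors by (intro card_SigmaI) (auto simp: V_def R_def)
  also have "\<dots> = (\<Sum>v\<in>V. if \<exists>i. \<not> 3 dvd v i then 81 else 0)"
  proof (rule sum.cong)
    fix v assume v: "v \<in> V"
    show "card (R v) = (if \<exists>i. \<not> 3 dvd v i then 81 else 0)"
    proof (cases "\<exists>i. \<not> 3 dvd v i")
      case True
      then obtain i where "\<not> 3 dvd v i" by blast
      then have "9 * card (R v) = 9 * 81"
        using card_isotropic_pairing_one[of v i] v N card by (simp add: R_def V_def)
      then show ?thesis using True by simp
    next
      case False
      then have "3 dvd dot r v" for r unfolding dot_def by (intro dvd_sum) auto
      then have "R v = {}" by (auto simp: R_def cong_def dvd_eq_mod_eq_0)
      then show ?thesis using False by simp
    qed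
  qed simp
  also have "\<dots> = 81 * card {v \<in> V. \<exists>i. \<not> 3 dvd v i}"
    by (subst sum.inter_filter[symmetric]) (auto simp: V_def finite_dot_eq)
  finally show ?thesis by (simp add: Z_def V_def)
qed

text \<open>A vector of norm 9N is primitive at 3 or three times a vector of norm N, and the same
  dichotomy for norm N accounts for the second term. In other words, this is the action of a Hecke
  operator at 9 on the theta series of the cubic lattice in dimension 6.\<close>

lemma neighbour_recurrence:
  fixes N :: int
  assumes card: "CARD('n::finite) = 6" and N: "3 dvd N"
  shows "card {v :: 'n \<Rightarrow> int. dot v v = 9 * N} + 81 * card {v :: 'n \<Rightarrow> int. 9 * dot v v = N}
    = 82 * card {v :: 'n \<Rightarrow> int. dot v v = N}"
proof -
  have imprim: "card {v :: 'n \<Rightarrow> int. dot v v = M \<and> (\<forall>i. 3 dvd v i)} = card {v :: 'n \<Rightarrow> int. 9 * dot v v = M}" for M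
  proof (rule bij_betw_same_card[OF bij_betw_byWitness[where f = "\<lambda>v i. v i div 3" and f' = "\<lambda>v i. 3 * v i"]])
    have 9: "dot (\<lambda>i. 3 * v i) (\<lambda>i. 3 * v i) = 9 * dot v v" for v :: "'n \<Rightarrow> int"
      by (simp add: dot_def sum_distrib_left algebra_simps)
    show "(\<lambda>v i. v i div 3) ` {v :: 'n \<Rightarrow> int. dot v v = M \<and> (\<forall>i. 3 dvd v i)} \<subseteq> {v. 9 * dot v v = M}"
      unfolding 9[symmetric] by auto
    show "(\<lambda>v i. 3 * v i) ` {v :: 'n \<Rightarrow> int. 9 * dot v v = M} \<subseteq> {v. dot v v = M \<and> (\<forall>i. 3 dvd v i)}"
      using 9 by auto
  qed auto
  have split: "card {v :: 'n \<Rightarrow> int. dot v v = M} = card {v :: 'n \<Rightarrow> int. dot v v = M \<and> (\<exists>i. \<not> 3 dvd v i)}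
      + card {v :: 'n \<Rightarrow> int. 9 * dot v v = M}" for M
    unfolding imprim[symmetric]
    by (subst card_Un_disjoint[symmetric])
      (auto intro!: arg_cong[of _ _ card] finite_subset[OF _ finite_dot_eq[of M]])
  show ?thesis
    using split[of "9 * N"] split[of N] card_primitive_norm_9[OF card N] by simp
qed

section \<open>All representations as six squares\<close>

lemma exhaust_6: fixes x :: 6
  shows "x = 0 \<or> x = 1 \<or> x = 2 \<or> x = 3 \<or> x = 4 \<or> x = 5"
proof (induct x)
  case (of_int z)
  then have "z = 0 \<or> z = 1 \<or> z = 2 \<or> z = 3 \<or> z = 4 \<or> z = 5" by fastforce
  then show ?case by auto
qed

lemma UNIV_6: "(UNIV :: 6 set) = {0, 1, 2, 3, 4, 5}"
  using exhaust_6 by auto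

definition odd_one_out :: "('n \<Rightarrow> int) \<Rightarrow> 'n \<Rightarrow> bool" where
  "odd_one_out v i \<longleftrightarrow> (\<forall>j. j \<noteq> i \<longrightarrow> odd (v i + v j))"

text \<open>Modulo 4 the norm counts the odd entries, so there are one or five of these.\<close>

lemma ex1_odd_one_out:
  fixes v :: "'n::finite \<Rightarrow> int"
  assumes card: "CARD('n) = 6" and v: "[dot v v = 1] (mod 4)"
  shows "\<exists>!i. odd_one_out v i"
proof -
  define O' where "O' = {i. odd (v i)}"
  have sq: "[v i * v i = (if i \<in> O' then 1 else 0)] (mod 4)" for i
  proof (cases "odd (v i)")
    case True
    then obtain m where "v i = 2 * m + 1" by (elim oddE)
    then have "v i * v i = 4 * (m * m + m) + 1" by (simp add: algebra_simps)
    then have "v i * v i - 1 = 4 * (m * m + m)" by simp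
    then show ?thesis using True by (simp add: O'_def cong_iff_dvd_diff)
  next
    case False
    then obtain m where "v i = 2 * m" by auto
    then have "v i * v i = 4 * (m * m)" by (simp add: algebra_simps)
    then show ?thesis using False by (simp add: O'_def cong_def)
  qed
  have "[dot v v = (\<Sum>i\<in>UNIV. if i \<in> O' then 1 else 0)] (mod 4)"
    unfolding dot_def by (intro cong_sum sq)
  then have "[int (card O') = 1] (mod 4)"
    using v by (simp add: sum.If_cases cong_def)
  moreover have "card O' \<le> 6" using card_mono[of UNIV O'] card by simp
  ultimately have "card O' = 1 \<or> card O' = 5"
  proof -
    define n where "n = card O'"
    assume "[int (card O') = 1] (mod 4)" "card O' \<le> 6"
    then have "int n mod 4 = 1" "n \<le> 6" by (auto simp: n_def cong_def)
    then have "n = 1 \<or> n = 5" by presburger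
    then show ?thesis by (simp add: n_def)
  qed
  moreover have "card (- O') = 6 - card O'" using card by (simp add: Compl_eq_Diff_UNIV card_Diff_subset)
  ultimately have "card O' = 1 \<or> card (- O') = 1" by auto
  then obtain i where "O' = {i} \<or> - O' = {i}" by (metis card_1_singletonE)
  then have i: "odd_one_out v i"
    by (auto simp: odd_one_out_def O'_def set_eq_iff)
  have "i' = i" if "odd_one_out v i'" for i'
  proof (rule ccontr)
    assume ne: "i' \<noteq> i"
    have "card {i, i'} \<noteq> card (UNIV :: 'n set)" using ne card by simp
    then obtain j where "j \<noteq> i" "j \<noteq> i'" by (metis UNIV_eq_I insert_iff)
    then show False using ne i that by (auto simp: odd_one_out_def)
  qed
  then show ?thesis using i by blast
qed

lemma dot_permute:
  assumes "bij p" shows "dot (v \<circ> p) (v \<circ> p) = dot v v"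
  unfolding dot_def using sum.reindex_bij_betw[OF assms, of "\<lambda>i. v i * v i"] by simp

lemma card_norm_eq_odd_one_out:
  fixes i0 :: "'n::finite"
  assumes card: "CARD('n) = 6" and N: "[N = 1] (mod 4)"
  shows "card {v :: 'n \<Rightarrow> int. dot v v = N} = 6 * card {v :: 'n \<Rightarrow> int. dot v v = N \<and> odd_one_out v i0}"
proof -
  define V where "V i = {v :: 'n \<Rightarrow> int. dot v v = N \<and> odd_one_out v i}" for i
  have ex1: "\<exists>!i. odd_one_out v i" if "dot v v = N" for v :: "'n \<Rightarrow> int"
    using ex1_odd_one_out[OF card] that N by blast
  have ex: "\<exists>i. odd_one_out v i" if "dot v v = N" for v :: "'n \<Rightarrow> int"
    using ex1[OF that] by blast
  have fin: "finite (V i)" for i unfolding V_def by (rule finite_subset[OF _ finite_dot_eq[of N]]) auto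
  have "{v :: 'n \<Rightarrow> int. dot v v = N} = (\<Union>i\<in>UNIV. V i)"
    using ex by (auto simp: V_def)
  moreover have "V i \<inter> V j = {}" if "i \<noteq> j" for i j
    using ex1 that unfolding V_def by blast
  ultimately have "card {v :: 'n \<Rightarrow> int. dot v v = N} = (\<Sum>i\<in>UNIV. card (V i))"
    using fin by (simp add: card_UN_disjoint)
  also have "\<dots> = (\<Sum>i\<in>(UNIV :: 'n set). card (V i0))"
  proof (rule sum.cong[OF refl])
    fix i
    show "card (V i) = card (V i0)"
    proof (rule bij_betw_same_card[OF bij_betw_byWitness[where f' = "\<lambda>v. v \<circ> Transposition.transpose i i0"]])
      let ?\<tau> = "Transposition.transpose i i0"
      have t: "v \<circ> ?\<tau> \<in> V (?\<tau> j)" if v: "v \<in> V j" for v j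
      proof -
        have "?\<tau> k \<noteq> j" if "k \<noteq> ?\<tau> j" for k using that by (metis transpose_involutory)
        then show ?thesis
          using v dot_permute[of ?\<tau> v] by (auto simp: V_def odd_one_out_def)
      qed
      show "(\<lambda>v. v \<circ> ?\<tau>) ` V i \<subseteq> V i0" using t[of _ i] by auto
      show "(\<lambda>v. v \<circ> ?\<tau>) ` V i0 \<subseteq> V i" using t[of _ i0] by auto
    qed (auto simp: comp_assoc)
  qed
  finally show ?thesis using card by (simp add: V_def)
qed

definition vec6 :: "int \<times> int \<times> int \<times> int \<times> int \<times> int \<Rightarrow> 6 \<Rightarrow> int" where
  "vec6 = (\<lambda>(s, t, a, b, c, d) i. if i = 0 then s else if i = 1 then t else if i = 2 then a
     else if i = 3 then b else if i = 4 then c else d)"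

text \<open>By symmetry the entry of exceptional parity may be moved to the first position, which
  costs a factor 6; sextuples allow it in two positions.\<close>

lemma card_six_squares_eq:
  assumes N: "[N = 1] (mod 4)"
  shows "card {v :: 6 \<Rightarrow> int. dot v v = N} = 3 * (card (sextuples_odd N) + card (sextuples_even N))"
proof -
  define S where "S = sextuples_odd N \<union> sextuples_even N"
  define T where "T = {x \<in> S. [(\<lambda>(s, t, a, b, c, d). t + a) x = 0] (mod 2)}"
  have S: "(s, t, a, b, c, d) \<in> S \<longleftrightarrow> odd (s + t) \<and> even (a + b) \<and> even (a + c) \<and> even (a + d) \<and>
      s\<^sup>2 + t\<^sup>2 + a\<^sup>2 + b\<^sup>2 + c\<^sup>2 + d\<^sup>2 = N" for s t a b c d
    by (auto simp: S_def sextuples_odd_def sextuples_even_def)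
  have "card S = nat 2 * card T" unfolding T_def
  proof (rule card_eq_mult_card_fibre[where \<sigma> = "\<lambda>(s, t, x). (t, s, x)" and c = 1])
    show "\<And>x. x \<in> S \<Longrightarrow> [case case x of (s, t, x) \<Rightarrow> (t, s, x) of (s, t, a, b, c, d) \<Rightarrow> t + a =
         (case x of (s, t, a, b, c, d) \<Rightarrow> t + a) + 1] (mod 2)"
      by (auto simp: S cong_iff_dvd_diff)
    show "finite S" by (simp add: S_def finite_sextuples)
  qed (auto simp: S inj_on_def algebra_simps)
  moreover have "card S = card (sextuples_odd N) + card (sextuples_even N)"
    unfolding S_def by (rule card_Un_disjoint) (auto simp: finite_sextuples, auto simp: sextuples_odd_def sextuples_even_def)
  moreover have "card T = card {v :: 6 \<Rightarrow> int. dot v v = N \<and> odd_one_out v 0}"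
  proof (rule bij_betw_same_card[OF bij_betw_byWitness[where f = vec6 
        and f' = "\<lambda>v :: 6 \<Rightarrow> int. (v 0, v 1, v 2, v 3, v 4, v 5)"]])
    have d: "dot v v = (v 0)\<^sup>2 + (v 1)\<^sup>2 + (v 2)\<^sup>2 + (v 3)\<^sup>2 + (v 4)\<^sup>2 + (v 5)\<^sup>2" for v :: "6 \<Rightarrow> int"
      unfolding dot_def UNIV_6 by (simp add: power2_eq_square)
    have o: "odd_one_out v 0 \<longleftrightarrow> odd (v 0 + v 1) \<and> odd (v 0 + v 2) \<and> odd (v 0 + v 3) \<and> odd (v 0 + v 4)
        \<and> odd (v 0 + v 5)" for v :: "6 \<Rightarrow> int"
    proof -
      have "odd_one_out v 0 \<longleftrightarrow> (\<forall>j\<in>UNIV. j \<noteq> 0 \<longrightarrow> odd (v 0 + v j))"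
        by (simp add: odd_one_out_def)
      then show ?thesis unfolding UNIV_6 by simp
    qed
    show "vec6 ` T \<subseteq> {v :: 6 \<Rightarrow> int. dot v v = N \<and> odd_one_out v 0}"
      by (auto simp: T_def S vec6_def d o cong_0_iff)
    show "(\<lambda>v :: 6 \<Rightarrow> int. (v 0, v 1, v 2, v 3, v 4, v 5)) ` {v. dot v v = N \<and> odd_one_out v 0} \<subseteq> T"
      by (auto simp: T_def S d o cong_0_iff)
    show "\<forall>v\<in>{v :: 6 \<Rightarrow> int. dot v v = N \<and> odd_one_out v 0}. vec6 (v 0, v 1, v 2, v 3, v 4, v 5) = v"
    proof (intro ballI ext)
      fix v :: "6 \<Rightarrow> int" and i :: 6
      show "vec6 (v 0, v 1, v 2, v 3, v 4, v 5) i = v i"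
        using exhaust_6[of i] by (auto simp: vec6_def)
    qed
  qed (auto simp: vec6_def)
  ultimately show ?thesis
    using card_norm_eq_odd_one_out[OF _ N, of "0 :: 6"] by simp
qed

text \<open>This is where the cusp form drops out. In general r(N) is only a combination of the
  sizes of the two kinds of sextuples, and it is proportional to A_4(n) because these sizes
  agree.\<close>

lemma six_squares_eq_A4:
  assumes N: "\<And>x y. 2 * (4 * int n + 5) \<noteq> x\<^sup>2 + (y::int)\<^sup>2"
  shows "card {v :: 6 \<Rightarrow> int. dot v v = 4 * int n + 5} = 384 * A\<^sub>4 n"
proof -
  define M where "M = 4 * int n + 5"
  define E where "E = {(s, t, a, b, c, d) \<in> sextuples_even M. 4 dvd a + b + c + d}"
  define O' where "O' = {(s, t, a, b, c, d) \<in> sextuples_even M. \<not> 4 dvd a + b + c + d}"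
  have "sextuples_even M = E \<union> O'" "E \<inter> O' = {}" by (auto simp: E_def O'_def)
  moreover have "finite E" "finite O'"
    using finite_sextuples(2)[of M] by (auto simp: E_def O'_def intro: finite_subset[rotated])
  ultimately have "card (sextuples_even M) = card E + card O'" by (simp add: card_Un_disjoint)
  moreover have "card E = card O'"
    unfolding E_def O'_def by (rule card_sextuples_even_balanced) (use N in \<open>simp add: M_def\<close>)
  moreover have "card (sextuples_odd M) = 2 * card O'" unfolding O'_def by (rule card_sextuples_odd)
  moreover have "[M = 1] (mod 4)" unfolding M_def cong_iff_dvd_diff by presburger
  ultimately show ?thesis
    using card_six_squares_eq[of M] A4_eq_card_sextuples_odd[of n] by (simp add: M_def)
qed

section \<open>The recursion and the divisibility by 6\<close>

lemma three_dvd_sum_two_squares: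
  fixes x y :: int
  assumes "3 dvd x\<^sup>2 + y\<^sup>2" shows "3 dvd x \<and> 3 dvd y"
proof -
  define a b where "a = x mod 3" and "b = y mod 3"
  have "a = 0 \<or> a = 1 \<or> a = 2" "b = 0 \<or> b = 1 \<or> b = 2"
    unfolding a_def b_def by presburger+
  moreover have "[a\<^sup>2 + b\<^sup>2 = x\<^sup>2 + y\<^sup>2] (mod 3)"
    unfolding a_def b_def by (intro cong_add cong_pow) (simp_all add: cong_def)
  then have "(a\<^sup>2 + b\<^sup>2) mod 3 = 0" using assms by (simp add: cong_def)
  ultimately have "a = 0 \<and> b = 0" by auto
  then show ?thesis by (simp add: a_def b_def dvd_eq_mod_eq_0)
qed

text \<open>Infinite descent at the prime 3, which is inert in the Gaussian integers.\<close>

lemma not_sum_two_squares: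
  fixes m :: int
  assumes "\<not> 3 dvd m"
  shows "x\<^sup>2 + y\<^sup>2 \<noteq> 3 ^ (2 * k + 1) * m"
proof -
  have step: "\<exists>u v. x = 3 * u \<and> y = 3 * v \<and> u\<^sup>2 + v\<^sup>2 = M" if "x\<^sup>2 + y\<^sup>2 = 9 * M" for x y M :: int
  proof -
    have "3 dvd x\<^sup>2 + y\<^sup>2" unfolding that by simp
    then obtain u v where "x = 3 * u" "y = 3 * v" using three_dvd_sum_two_squares by (metis dvdE)
    then show ?thesis using that by (auto simp: power2_eq_square)
  qed
  show ?thesis
  proof (induction k arbitrary: x y)
    case 0
    show ?case
    proof
      assume eq: "x\<^sup>2 + y\<^sup>2 = 3 ^ (2 * 0 + 1) * m"
      then have "3 dvd x\<^sup>2 + y\<^sup>2" by simp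
      then obtain u v where "x = 3 * u" "y = 3 * v" using three_dvd_sum_two_squares by (metis dvdE)
      then have "m = 3 * (u\<^sup>2 + v\<^sup>2)" using eq by (simp add: power2_eq_square)
      then show False using assms by simp
    qed
  next
    case (Suc k)
    show ?case
    proof
      assume "x\<^sup>2 + y\<^sup>2 = 3 ^ (2 * Suc k + 1) * m"
      then have "x\<^sup>2 + y\<^sup>2 = 9 * (3 ^ (2 * k + 1) * m)" by simp
      then show False using step Suc.IH by blast
    qed
  qed
qed

text \<open>The solutions of q^2 + 2y^2 + 2z^2 = 8n + 5 in odd integers form orbits of 16 elements
  under changes of sign and the exchange of y and z: for y = z or y = -z the equation would read
  q^2 + (2y)^2 = 8n + 5.\<close>

lemma two_dvd_card_cores:
  assumes N: "\<nexists>x y. 8 * int n + 5 = x\<^sup>2 + (y::int)\<^sup>2"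
  shows "2 dvd card (cores n)"
proof -
  define M where "M = 8 * int n + 5"
  define flip where "flip w = (if w > 0 then 0 else 1 :: int)" for w :: int
  have flip: "[flip (- w) = flip w + 1] (mod 2)" "[flip w = 0] (mod 2) \<longleftrightarrow> w > 0" if "odd w" for w
    using that by (auto simp: flip_def cong_def)
  \<comment> \<open>Four choices, each of one element out of two, lead to the factor 16.\<close>
  define S1 where "S1 = {(q, y, z) \<in> odd_triples M. q > 0}"
  define S2 where "S2 = {(q, y, z) \<in> S1. y > 0}"
  define S3 where "S3 = {(q, y, z) \<in> S2. z > 0}"
  define S4 where "S4 = {(q, y, z) \<in> S3. y < z}"
  have "S1 \<subseteq> odd_triples M" "S2 \<subseteq> S1" "S3 \<subseteq> S2" by (auto simp: S3_def S2_def S1_def)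
  then have fin: "finite (odd_triples M)" "finite S1" "finite S2" "finite S3"
    using finite_odd_triples[of M] by (meson finite_subset)+
  have "card (odd_triples M) = nat 2 * card {x \<in> odd_triples M. [(\<lambda>(q, y, z). flip q) x = 0] (mod 2)}"
    by (rule card_eq_mult_card_fibre[OF fin(1), where \<sigma> = "\<lambda>(q, y, z). (- q, y, z)" and c = 1])
      (auto simp: odd_triples_def inj_on_def flip)
  also have "{x \<in> odd_triples M. [(\<lambda>(q, y, z). flip q) x = 0] (mod 2)} = S1"
    by (auto simp: S1_def odd_triples_def flip)
  also have "card S1 = nat 2 * card {x \<in> S1. [(\<lambda>(q, y, z). flip y) x = 0] (mod 2)}"
    by (rule card_eq_mult_card_fibre[OF fin(2), where \<sigma> = "\<lambda>(q, y, z). (q, - y, z)" and c = 1])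
      (auto simp: S1_def odd_triples_def inj_on_def flip)
  also have "{x \<in> S1. [(\<lambda>(q, y, z). flip y) x = 0] (mod 2)} = S2"
    by (auto simp: S2_def S1_def odd_triples_def flip)
  also have "card S2 = nat 2 * card {x \<in> S2. [(\<lambda>(q, y, z). flip z) x = 0] (mod 2)}"
    by (rule card_eq_mult_card_fibre[OF fin(3), where \<sigma> = "\<lambda>(q, y, z). (q, y, - z)" and c = 1])
      (auto simp: S2_def S1_def odd_triples_def inj_on_def flip)
  also have "{x \<in> S2. [(\<lambda>(q, y, z). flip z) x = 0] (mod 2)} = S3"
    by (auto simp: S3_def S2_def S1_def odd_triples_def flip)
  also have "card S3 = nat 2 * card {x \<in> S3. [(\<lambda>(q, y, z). if y < z then 0 else 1 :: int) x = 0] (mod 2)}"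
  proof (rule card_eq_mult_card_fibre[OF fin(4), where \<sigma> = "\<lambda>(q, y, z). (q, z, y)" and c = 1])
    fix x assume x: "x \<in> S3"
    obtain q y z where qyz: "x = (q, y, z)" by (cases x)
    have "q\<^sup>2 + 2 * y\<^sup>2 + 2 * z\<^sup>2 = M" using x by (auto simp: qyz S3_def S2_def S1_def odd_triples_def)
    moreover have "q\<^sup>2 + 2 * y\<^sup>2 + 2 * y\<^sup>2 = q\<^sup>2 + (2 * y)\<^sup>2" by (simp add: power2_eq_square)
    ultimately have "y \<noteq> z" using N unfolding M_def by metis
    then show "[case case x of (q, y, z) \<Rightarrow> (q, z, y) of (q, y, z) \<Rightarrow> if y < z then 0 else (1 :: int) =
        (case x of (q, y, z) \<Rightarrow> if y < z then 0 else 1) + 1] (mod 2)"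
      by (auto simp: qyz cong_def)
  qed (auto simp: S3_def S2_def S1_def odd_triples_def inj_on_def)
  finally show ?thesis using card_cores[of n] by (simp add: M_def)
qed

lemma even_sum_symmetric:
  fixes f :: "nat \<Rightarrow> nat"
  assumes "\<And>i. i \<le> n \<Longrightarrow> f (n - i) = f i" "\<And>m. n = 2 * m \<Longrightarrow> 2 dvd f m"
  shows "2 dvd (\<Sum>i\<le>n. f i)"
proof -
  define A where "A = {i. i \<le> n \<and> 2 * i < n}"
  define B where "B = {i. i \<le> n \<and> n < 2 * i}"
  define C where "C = {i. n = 2 * i}"
  have fin: "finite A" "finite B" by (auto simp: A_def B_def)
  have finC: "finite C" by (rule finite_subset[of _ "{..n}"]) (auto simp: C_def)
  have "{..n} = A \<union> B \<union> C" by (auto simp: A_def B_def C_def)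
  then have "(\<Sum>i\<le>n. f i) = sum f (A \<union> B \<union> C)" by simp
  also have "\<dots> = sum f A + sum f B + sum f C"
    using fin finC by (subst sum.union_disjoint; (subst sum.union_disjoint)?) (auto simp: A_def B_def C_def)
  also have "sum f B = sum f A"
    by (rule sum.reindex_bij_witness[of _ "\<lambda>i. n - i" "\<lambda>i. n - i"]) (auto simp: A_def B_def assms(1))
  finally have "(\<Sum>i\<le>n. f i) = 2 * sum f A + sum f C" by simp
  moreover have "2 dvd sum f C" by (rule dvd_sum) (auto simp: C_def assms(2))
  ultimately show ?thesis by simp
qed

text \<open>Modulo 2, exchanging the two cores leaves the pairs of equal size, and their number is
  the square of an even number. Modulo 3, the sextuples with four odd last entries are twice as
  many as a set with a free action of the cyclic group of order 3.\<close>

lemma six_dvd_A4: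
  assumes N: "\<And>x y. 4 * int n + 5 \<noteq> x\<^sup>2 + (y::int)\<^sup>2" "\<And>x y. 2 * (4 * int n + 5) \<noteq> x\<^sup>2 + (y::int)\<^sup>2"
  shows "6 dvd A\<^sub>4 n"
proof -
  have "2 dvd A\<^sub>4 n" unfolding A4_eq_sum
  proof (rule even_sum_symmetric)
    fix m assume "n = 2 * m"
    then have "2 dvd card (cores m)" using N(1) by (intro two_dvd_card_cores) simp
    then show "2 dvd card (cores m) * card (cores (n - m))" by simp
  qed (simp add: mult.commute)
  moreover have "3 dvd A\<^sub>4 n"
  proof -
    define N where "N = 4 * int n + 5"
    have "64 * A\<^sub>4 n = 2 * card {(s, t, a, b, c, d) \<in> sextuples_even N. 4 dvd a + b + c + d}"
      using A4_eq_card_sextuples_odd[of n] card_sextuples_odd[of N] card_sextuples_even_balanced[of N] assms(2) by (simp add: N_def)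
    moreover have "3 dvd card {(s, t, a, b, c, d) \<in> sextuples_even N. 4 dvd a + b + c + d}"
      using three_dvd_card_sextuples_even[of N] assms(1) by (simp add: N_def)
    ultimately show ?thesis by presburger
  qed
  ultimately show ?thesis by presburger
qed

theorem theorem1p2:
  fixes n k :: nat
  assumes "\<not> 3 dvd n"
  shows "A\<^sub>4 (3 ^ (2 * k + 1) * n + (3 ^ (2 * k + 2) - 5) div 4)
           = ((3 ^ (4 * k + 4) - 1) div 80) * A\<^sub>4 (3 * n + 1)
       \<and> [A\<^sub>4 (3 ^ (2 * k + 1) * n + (3 ^ (2 * k + 2) - 5) div 4) = 0]
           (mod (3 * (3 ^ (4 * k + 4) - 1)) div 40)"
proof -
  define m where "m = 4 * int n + 3"
  have m3: "\<not> 3 dvd m" "\<not> 3 dvd 2 * m"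
    using assms unfolding m_def by presburger+
  define ind where "ind k = 3 ^ (2 * k + 1) * n + (3 ^ (2 * k + 2) - 5) div 4" for k
  have ind: "4 * int (ind k) + 5 = 3 ^ (2 * k + 1) * m" for k
  proof -
    obtain j where j: "(3::nat) ^ (2 * k + 2) = 4 * j + 5"
      using nine_power_exact[of k] by (metis dvdE le_add_diff_inverse2)
    have i: "ind k = 3 ^ (2 * k + 1) * n + j" unfolding ind_def j by simp
    have "4 * int j + 5 = 3 ^ (2 * k + 2)" using arg_cong[OF j, of int] by simp
    then show ?thesis unfolding i m_def by (simp add: algebra_simps)
  qed
  have nosq: "4 * int (ind k) + 5 \<noteq> x\<^sup>2 + y\<^sup>2" "2 * (4 * int (ind k) + 5) \<noteq> x\<^sup>2 + y\<^sup>2" for k and x y :: int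
    unfolding ind using not_sum_two_squares[OF m3(1), of x y k] not_sum_two_squares[OF m3(2), of x y k]
    by (auto simp: algebra_simps)
  define R where "R N = card {v :: 6 \<Rightarrow> int. dot v v = N}" for N
  have R: "R (3 ^ (2 * k + 1) * m) = 384 * A\<^sub>4 (ind k)" for k
    unfolding R_def ind[symmetric] by (rule six_squares_eq_A4) (rule nosq)
  have rec: "R (3 ^ (2 * Suc k + 1) * m) + 81 * card {v :: 6 \<Rightarrow> int. 9 * dot v v = 3 ^ (2 * k + 1) * m}
      = 82 * R (3 ^ (2 * k + 1) * m)" for k
    using neighbour_recurrence[where 'n = 6, of "3 ^ (2 * k + 1) * m"] by (simp add: R_def algebra_simps)
  have "{v :: 6 \<Rightarrow> int. 9 * dot v v = 3 ^ (2 * 0 + 1) * m} = {}"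
  proof -
    have "9 * d \<noteq> 3 * m" for d using m3(1) by presburger
    then show ?thesis by auto
  qed
  then have A1: "A\<^sub>4 (ind 1) = 82 * A\<^sub>4 (ind 0)" using rec[of 0] R[of 0] R[of 1] by simp
  have A2: "A\<^sub>4 (ind (Suc (Suc k))) + 81 * A\<^sub>4 (ind k) = 82 * A\<^sub>4 (ind (Suc k))" for k
  proof -
    have "{v :: 6 \<Rightarrow> int. 9 * dot v v = 3 ^ (2 * Suc k + 1) * m} = {v. dot v v = 3 ^ (2 * k + 1) * m}" by auto
    then show ?thesis using rec[of "Suc k"] R[of k] R[of "Suc k"] R[of "Suc (Suc k)"] by (simp add: R_def)
  qed
  \<comment> \<open>The characteristic root 81 is split off, which leaves a recursion of order one.\<close>
  have step: "A\<^sub>4 (ind (Suc k)) = 81 * A\<^sub>4 (ind k) + A\<^sub>4 (ind 0)" for k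
  proof (induction k)
    case 0 show ?case using A1 by simp
  next
    case (Suc k) then show ?case using A2[of k] by simp
  qed
  have closed: "80 * A\<^sub>4 (ind k) + A\<^sub>4 (ind 0) = 3 ^ (4 * k + 4) * A\<^sub>4 (ind 0)" for k
  proof (induction k)
    case (Suc k)
    have "(3::nat) ^ (4 * Suc k + 4) = 81 * 3 ^ (4 * k + 4)" by (simp add: power_add)
    then show ?case using Suc step[of k] by simp
  qed simp
  have i0: "ind 0 = 3 * n + 1" by (simp add: ind_def)
  obtain j where j: "(3::nat) ^ (4 * k + 4) - 1 = 80 * j" 
    using eightyone_power_exact(1)[of k] by (elim dvdE)
  moreover have "(3::nat) ^ (4 * k + 4) \<noteq> 0" by simp
  ultimately have j1: "(3::nat) ^ (4 * k + 4) = 80 * j + 1" by linarith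
  have main: "A\<^sub>4 (ind k) = j * A\<^sub>4 (3 * n + 1)"
    using closed[of k] unfolding j1 i0 by (simp add: algebra_simps)
  obtain a where a: "A\<^sub>4 (3 * n + 1) = 6 * a"
    using six_dvd_A4[of "ind 0", OF nosq] unfolding i0 by (elim dvdE)
  have "A\<^sub>4 (ind k) = ((3 ^ (4 * k + 4) - 1) div 80) * A\<^sub>4 (3 * n + 1)"
    unfolding j main by simp
  moreover have mod: "(3 * ((3::nat) ^ (4 * k + 4) - 1)) div 40 = 6 * j" unfolding j by simp
  have "[A\<^sub>4 (ind k) = 0] (mod (3 * (3 ^ (4 * k + 4) - 1)) div 40)"
    unfolding mod cong_0_iff main a by simp
  ultimately show ?thesis unfolding ind_def by blast
qed

end
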